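(* For every $(\alpha,h)\in\mathcal{U}^{rs}\setminus\{(\alpha_c,h_c)\}$, $$\sqrt2\,\frac{S_n-\frac{n^2}{2}\bar m_n(\alpha,h)}{n}\longrightarrow\mathcal{N}(0,v(\alpha,h))\quad\text{in distribution with respect to } \bar{\mathbb{P}}_{n;\alpha,h},\ \text{ as } n\to+\infty,$$ where $\mathcal{N}(0,v(\alpha,h))$ is a centered Gaussian distribution with variance $$v(\alpha,h):=\lim_{n\to+\infty}v_n(\alpha,h)=\partial_hu^*(\alpha,h).$$
   Context: Mean-field model. For $n\in\mathbb{N}$ let $\mathcal{E}_n$ be the edge set of the complete graph on $n$ labeled vertices (so $|\mathcal{E}_n|=\binom n2$) and $\mathcal{A}_n=\{0,1\}^{\mathcal{E}_n}$. For $\alpha,h\in\mathbb{R}$ and $x\in\mathcal{A}_n$ set $\bar{\mathcal{H}}_{n;\alpha,h}(x)=\frac{4\alpha}{3n^4}\left(\sum_{i\in\mathcal{E}_n}x_i\right)^3+h\sum_{i\in\mathcal{E}_n}x_i$. Let $\bar{\mathbb{P}}_{n;\alpha,h}$ be the probability measure on $\mathcal{A}_n$ with density $e^{\bar{\mathcal{H}}_{n;\alpha,h}(x)}/\bar Z_{n;\alpha,h}$, $\bar Z_{n;\alpha,h}=\sum_{x\in\mathcal{A}_n}e^{\bar{\mathcal{H}}_{n;\alpha,h}(x)}$, with expectation $\bar{\mathbb{E}}_{n;\alpha,h}$, and let $S_n(x)=\sum_{i\in\mathcal{E}_n}x_i$. Define $\bar m_n(\alpha,h):=\bar{\mathbb{E}}_{n;\alpha,h}\left(\frac{2S_n}{n^2}\right)$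 and $v_n(\alpha,h):=\partial_h\bar m_n(\alpha,h)$. Let $I(u)=u\ln u+(1-u)\ln(1-u)$ on $[0,1]$ (with $0\ln 0=0$). For $\alpha>-2$ consider the scalar problem $\sup_{0\le u\le1}\left(\frac\alpha6u^3+\frac h2u-\frac12I(u)\right)$. It is known that it has a unique maximizer, denoted $u^*(\alpha,h)$, except when $(\alpha,h)$ lies on a critical curve $\mathcal{M}^{rs}=\{(\alpha,h):\alpha>\alpha_c,\ h<h_c,\ h=q(\alpha)\}$ ($q$ a continuous, strictly decreasing function), on which there are exactly two maximizers; here $(\alpha_c,h_c)=\left(\frac{27}{8},\ln2-\frac32\right)$. Set $\mathcal{U}^{rs}=\left((-2,+\infty)\times\mathbb{R}\right)\setminus\mathcal{M}^{rs}$. *)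

theory Defs
  imports "HOL-Probability.Probability"
begin

definition edges :: "nat \<Rightarrow> nat set set" where
  "edges n = {e. e \<subseteq> {1..n} \<and> card e = 2}"

definition configs :: "nat \<Rightarrow> (nat set \<Rightarrow> real) set" where
  "configs n = (edges n \<rightarrow>\<^sub>E {0, 1})"

definition S_n :: "nat \<Rightarrow> (nat set \<Rightarrow> real) \<Rightarrow> real" where
  "S_n n x = (\<Sum>e\<in>edges n. x e)"

definition hamiltonian :: "nat \<Rightarrow> real \<Rightarrow> real \<Rightarrow> (nat set \<Rightarrow> real) \<Rightarrow> real" where
  "hamiltonian n \<alpha> h x =
     4 * \<alpha> / (3 * real n ^ 4) * (\<Sum>e\<in>edges n. x e) ^ 3 + h * (\<Sum>e\<in>edges n. x e)"

definition partition_fun :: "nat \<Rightarrow> real \<Rightarrow> real \<Rightarrow> real" where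
  "partition_fun n \<alpha> h = (\<Sum>x\<in>configs n. exp (hamiltonian n \<alpha> h x))"

definition mf_measure :: "nat \<Rightarrow> real \<Rightarrow> real \<Rightarrow> (nat set \<Rightarrow> real) measure" where
  "mf_measure n \<alpha> h =
     point_measure (configs n) (\<lambda>x. exp (hamiltonian n \<alpha> h x) / partition_fun n \<alpha> h)"

definition m_n :: "nat \<Rightarrow> real \<Rightarrow> real \<Rightarrow> real" where
  "m_n n \<alpha> h = (\<integral>x. 2 * S_n n x / real n ^ 2 \<partial>mf_measure n \<alpha> h)"

definition v_n :: "nat \<Rightarrow> real \<Rightarrow> real \<Rightarrow> real" where
  "v_n n \<alpha> h = deriv (\<lambda>t. m_n n \<alpha> t) h"

definition v_lim :: "real \<Rightarrow> real \<Rightarrow> real" where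
  "v_lim \<alpha> h = lim (\<lambda>n. v_n n \<alpha> h)"

definition entropy_fun :: "real \<Rightarrow> real" where
  "entropy_fun u = u * ln u + (1 - u) * ln (1 - u)"

definition scalar_obj :: "real \<Rightarrow> real \<Rightarrow> real \<Rightarrow> real" where
  "scalar_obj \<alpha> h u = \<alpha> / 6 * u ^ 3 + h / 2 * u - 1 / 2 * entropy_fun u"

definition maximizers :: "real \<Rightarrow> real \<Rightarrow> real set" where
  "maximizers \<alpha> h = {u. is_arg_max (scalar_obj \<alpha> h) (\<lambda>u. u \<in> {0..1}) u}"

(* The unique maximizer; an unspecified value where the maximizer is not unique. *)
definition u_star :: "real \<Rightarrow> real \<Rightarrow> real" where
  "u_star \<alpha> h = (THE u. u \<in> maximizers \<alpha> h)"

definition \<alpha>\<^sub>c :: real where "\<alpha>\<^sub>c = 27 / 8"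

definition h\<^sub>c :: real where "h\<^sub>c = ln 2 - 3 / 2"

(* The critical curve has no closed form: for \<alpha> > \<alpha>\<^sub>c, the number q_crit \<alpha> is the only field h
   at which the scalar problem has two maximizers. *)
definition q_crit :: "real \<Rightarrow> real" where
  "q_crit \<alpha> = (THE h. card (maximizers \<alpha> h) = 2)"

definition M_rs :: "(real \<times> real) set" where
  "M_rs = {(\<alpha>, h). \<alpha> > \<alpha>\<^sub>c \<and> h < h\<^sub>c \<and> h = q_crit \<alpha>}"

definition U_rs :: "(real \<times> real) set" where
  "U_rs = ({-2<..} \<times> UNIV) - M_rs"

end

theory Submission
  imports Defs "HOL-Real_Asymp.Real_Asymp"
begin

text \<open>
  Under the Gibbs measure the number \<open>S\<close> of edges takes the value \<open>k\<close> with probability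
  proportional to \<open>w k = (N choose k) * exp (4 * \<alpha> / (3 * n ^ 4) * k ^ 3 + h * k)\<close>, where
  \<open>N = n choose 2\<close>. With \<open>T = N + 1\<close> the logarithm of \<open>w k\<close> is, up to a constant and to
  lower-order terms, \<open>T * F (k / T)\<close>, where
  \<open>F u = \<alpha> / 3 * u ^ 3 + h * u - (u * ln u + (1 - u) * ln (1 - u))\<close>
  is twice the objective of the scalar problem. Everything follows from Laplace's method
  for the sum of the weights.

  \<^emph>\<open>The maximizer.\<close> The second derivative of \<open>F\<close> has the sign of
  \<open>2 * \<alpha> * u ^ 2 * (1 - u) - 1\<close>, and \<open>u ^ 2 * (1 - u)\<close> increases up to \<open>u = 2/3\<close> and decreases
  afterwards. Hence there is at most one maximizer on either side of \<open>2/3\<close>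
  (\<open>maximizers_separated\<close>). Maximizers are monotone in \<open>h\<close>, so two of them can coexist for only
  one value of \<open>h\<close>, and comparison with the critical parameters shows that this value lies on the
  critical curve (\<open>unique_maximizer\<close>). The shape of the cubic also shows that
  the second derivative \<open>F'' u\<close> at a maximizer vanishes for the critical parameters only (\<open>maximizer_nondegenerate\<close>).
  Consequently \<open>F v = F u + q v * (v - u) ^ 2\<close> on the whole of \<open>[0, 1]\<close> with a continuous negative
  function \<open>q\<close> (\<open>quadratic_factor\<close>), and the inverse function rule gives
  \<open>- 1 / F'' u\<close> for the derivative of the maximizer in \<open>h\<close> (\<open>DERIV_u_star\<close>).

  \<^emph>\<open>The weights.\<close> The increments of \<open>ln (N choose k)\<close> are values of the derivative of the
  entropy, which is monotone. Therefore \<open>ln (N choose k) - ln (N choose j)\<close> lies between two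
  exact differences of \<open>T\<close> times the entropy, one taken at \<open>k / T, j / T\<close> and the other at
  \<open>(k + 1) / T, (j + 1) / T\<close> (\<open>choose_log_sandwich\<close>). This replaces Stirling's formula: with the factorization
  of \<open>F\<close> it yields both a Gaussian upper bound for the weights, uniform in \<open>k\<close> and \<open>n\<close>
  (\<open>ratio_upper\<close>), and their pointwise limit on the scale \<open>sqrt T\<close> around \<open>T * u\<close>
  (\<open>ratio_tendsto\<close>). The limit is a Gaussian density, up to a constant factor, of variance
  \<open>- 1 / F'' u\<close>. Its centre need not be \<open>0\<close>, since the coupling constant seen on the scale \<open>T\<close>
  differs from \<open>\<alpha>\<close> by a term of order \<open>1 / n\<close>.

  \<^emph>\<open>The averages.\<close> A sum over the lattice is the integral of a step function, so dominated
  convergence turns the Gibbs averages of functions of quadratic growth into Gaussian integrals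
  (\<open>gibbs_mean_tendsto\<close>). Applied to the first two centred moments this gives the limit of
  \<open>v_n\<close>, because the derivative of \<open>m_n\<close> in \<open>h\<close> is \<open>2 / n ^ 2\<close> times the variance of \<open>S\<close>; applied to
  indicators of half-lines it gives the convergence of the distribution functions. As \<open>S\<close> is centred
  at its exact mean, the displacement of the Gaussian profile cancels.
\<close>

section \<open>The free energy and its derivatives\<close>

text \<open>
  Twice the scalar objective. The weight of \<open>k\<close> edges has exponent \<open>T\<close> times this function,
  with no further factor \<open>1/2\<close>.
\<close>

definition free_energy :: "real \<Rightarrow> real \<Rightarrow> real \<Rightarrow> real" where
  "free_energy a h u = a / 3 * u ^ 3 + h * u - entropy_fun u"

definition slope :: "real \<Rightarrow> real \<Rightarrow> real \<Rightarrow> real" where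
  "slope a h u = a * u ^ 2 + h - ln u + ln (1 - u)"

definition curv :: "real \<Rightarrow> real \<Rightarrow> real" where
  "curv a u = 2 * a * u - 1 / u - 1 / (1 - u)"

lemma continuous_on_x_ln_x: "continuous_on {0..} (\<lambda>x::real. x * ln x)"
  unfolding continuous_on_eq_continuous_within
proof
  fix x :: real assume "x \<in> {0..}"
  show "continuous (at x within {0..}) (\<lambda>x. x * ln x)"
  proof (cases "x = 0")
    case False
    then have "isCont (\<lambda>x. x * ln x) x" using \<open>x \<in> {0..}\<close> by (intro continuous_intros) auto
    then show ?thesis using continuous_at_imp_continuous_at_within by blast
  next
    case True
    have "((\<lambda>x::real. inverse x * ln (inverse x)) \<longlongrightarrow> 0) at_top"
    proof (rule Lim_transform_eventually)
      show "((\<lambda>x::real. - (ln x / x)) \<longlongrightarrow> 0) at_top"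
        using tendsto_minus[OF ln_x_over_x_tendsto_0] by simp
      show "\<forall>\<^sub>F x::real in at_top. - (ln x / x) = inverse x * ln (inverse x)"
        using eventually_gt_at_top[of 0] by eventually_elim (simp add: ln_inverse divide_inverse)
    qed
    then have "((\<lambda>x::real. x * ln x) \<longlongrightarrow> 0) (at_right 0)"
      by (simp add: filterlim_at_right_to_top)
    moreover have "at 0 within {0..} = at_right (0::real)"
      by (metis at_within_Ici_at_right)
    ultimately show ?thesis using True by (simp add: continuous_within)
  qed
qed

lemma continuous_on_entropy: "continuous_on {0..1} entropy_fun"
proof -
  have "continuous_on {0..1} (\<lambda>u::real. u * ln u)"
    using continuous_on_x_ln_x by (rule continuous_on_subset) auto
  moreover have "continuous_on {0..1} (\<lambda>u::real. (1 - u) * ln (1 - u))"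
    by (rule continuous_on_compose2[OF continuous_on_x_ln_x]) (auto intro!: continuous_intros)
  ultimately show ?thesis unfolding entropy_fun_def[abs_def] by (rule continuous_on_add)
qed

lemma DERIV_entropy:
  "0 < u \<Longrightarrow> u < 1 \<Longrightarrow> (entropy_fun has_real_derivative ln u - ln (1 - u)) (at u)"
  unfolding entropy_fun_def[abs_def]
  by (auto intro!: derivative_eq_intros)

lemma continuous_on_free_energy: "continuous_on {0..1} (free_energy a h)"
  unfolding free_energy_def[abs_def] by (intro continuous_intros continuous_on_entropy) auto

lemma DERIV_free_energy:
  "0 < u \<Longrightarrow> u < 1 \<Longrightarrow> (free_energy a h has_real_derivative slope a h u) (at u)"
  unfolding free_energy_def[abs_def] slope_def
  by (auto intro!: derivative_eq_intros DERIV_entropy simp: field_simps power2_eq_square)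

lemma DERIV_slope:
  "0 < u \<Longrightarrow> u < 1 \<Longrightarrow> (slope a h has_real_derivative curv a u) (at u)"
  unfolding slope_def[abs_def] curv_def
  by (auto intro!: derivative_eq_intros simp: field_simps)

lemma maximizers_iff:
  "u \<in> maximizers a h \<longleftrightarrow> u \<in> {0..1} \<and> (\<forall>v\<in>{0..1}. free_energy a h v \<le> free_energy a h u)"
proof -
  have "free_energy a h v = 2 * scalar_obj a h v" for v
    by (simp add: scalar_obj_def free_energy_def)
  then have "scalar_obj a h v \<le> scalar_obj a h w \<longleftrightarrow> free_energy a h v \<le> free_energy a h w" for v w
    by simp
  then show ?thesis by (auto simp: maximizers_def is_arg_max_linorder)
qed

lemma ex_maximizer: "\<exists>u. u \<in> maximizers a h"
  using continuous_attains_sup[OF _ _ continuous_on_free_energy, of a h]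
  by (auto simp: maximizers_iff Bex_def)

lemma x_ln_x_nonpos: "0 \<le> u \<Longrightarrow> u \<le> 1 \<Longrightarrow> u * ln u \<le> (0::real)"
  by (cases "u = 0") (auto intro: mult_nonneg_nonpos)

text \<open>
  The entropy has slope \<open>+\<infinity>\<close> at the endpoints: a step of size \<open>w\<close> into the interval gains at least
  \<open>w * ln (1 / w)\<close> and loses at most a multiple of \<open>w\<close>, so an endpoint is never optimal. The step
  \<open>w = exp (- (\<bar>a\<bar> + \<bar>h\<bar> + 1))\<close> is small enough for the gain to win.
\<close>

lemma maximizer_interior:
  assumes "u \<in> maximizers a h" shows "0 < u" "u < 1"
proof -
  define w where "w = exp (- (\<bar>a\<bar> + \<bar>h\<bar> + 1))"
  have w: "0 < w" "w < 1" "ln w = - (\<bar>a\<bar> + \<bar>h\<bar> + 1)" by (auto simp: w_def)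
  have max: "free_energy a h v \<le> free_energy a h u" if "v \<in> {0..1}" for v
    using assms that by (auto simp: maximizers_iff)
  have ent: "entropy_fun w \<le> - w * (\<bar>a\<bar> + \<bar>h\<bar> + 1)" "entropy_fun (1 - w) = entropy_fun w"
    using x_ln_x_nonpos[of "1 - w"] w by (simp_all add: entropy_fun_def ring_distribs)
  have hw: "\<bar>h * w\<bar> \<le> \<bar>h\<bar> * w" using w by (simp add: abs_mult)
  show "0 < u"
  proof (rule ccontr)
    assume "\<not> 0 < u"
    then have "u = 0" using assms by (auto simp: maximizers_iff)
    then have "a / 3 * w ^ 3 + h * w - entropy_fun w \<le> 0"
      using max[of w] w by (simp add: free_energy_def entropy_fun_def)
    moreover have "\<bar>a / 3 * w ^ 3\<bar> \<le> \<bar>a\<bar> * w"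
    proof -
      have "w ^ 3 \<le> w" using w power_decreasing[of 1 3 w] by simp
      then have "\<bar>a\<bar> * w ^ 3 \<le> \<bar>a\<bar> * w" by (rule mult_left_mono) simp
      moreover have "0 \<le> \<bar>a\<bar> * w" using w by simp
      moreover have "\<bar>a / 3 * w ^ 3\<bar> = \<bar>a\<bar> * w ^ 3 / 3" using w by (simp add: abs_mult)
      ultimately show ?thesis by linarith
    qed
    ultimately show False using ent hw w by (simp add: algebra_simps abs_le_iff)
  qed
  show "u < 1"
  proof (rule ccontr)
    assume "\<not> u < 1"
    then have "u = 1" using assms by (auto simp: maximizers_iff)
    then have "a / 3 * (1 - w) ^ 3 + h * (1 - w) - entropy_fun (1 - w) \<le> a / 3 + h"
      using max[of "1 - w"] w by (simp add: free_energy_def entropy_fun_def)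
    moreover have "\<bar>a / 3 * ((1 - w) ^ 3 - 1)\<bar> \<le> \<bar>a\<bar> * w"
    proof -
      have e: "(1 - w) ^ 3 - 1 = - (w * (3 - 3 * w + w ^ 2))"
        by (simp add: power3_eq_cube power2_eq_square algebra_simps)
      have "w\<^sup>2 \<le> w" using w by (simp add: power2_eq_square mult_left_le)
      then have "\<bar>3 - 3 * w + w ^ 2\<bar> \<le> 3" using w by (auto simp: abs_le_iff)
      then have "\<bar>(1 - w) ^ 3 - 1\<bar> \<le> w * 3" unfolding e abs_minus_cancel abs_mult
        using w by (intro mult_mono) auto
      then have "\<bar>a\<bar> * \<bar>(1 - w) ^ 3 - 1\<bar> \<le> \<bar>a\<bar> * (w * 3)" by (rule mult_left_mono) simp
      then show ?thesis by (simp add: abs_mult)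
    qed
    then have "- (\<bar>a\<bar> * w) \<le> a / 3 * (1 - w) ^ 3 - a / 3"
      unfolding abs_le_iff by (simp add: right_diff_distrib)
    moreover have "h * w \<le> \<bar>h\<bar> * w" using hw by (rule abs_le_D1)
    moreover have "entropy_fun w \<le> - (\<bar>a\<bar> * w) - \<bar>h\<bar> * w - w" using ent(1) by (simp add: algebra_simps)
    moreover have "h * (1 - w) = h - h * w" by (simp add: algebra_simps)
    ultimately show False using ent(2) w by linarith
  qed
qed

lemma maximizer_slope: "u \<in> maximizers a h \<Longrightarrow> slope a h u = 0"
proof -
  assume u: "u \<in> maximizers a h"
  note i = maximizer_interior[OF u]
  show ?thesis
  proof (rule DERIV_local_max[OF DERIV_free_energy[OF i]])
    show "0 < min u (1 - u)" using i by simp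
    show "\<forall>y. \<bar>u - y\<bar> < min u (1 - u) \<longrightarrow> free_energy a h y \<le> free_energy a h u"
      using u i by (auto simp: maximizers_iff abs_less_iff)
  qed
qed

lemma slope_diff:
  assumes "0 < x" "x < y" "y < 1"
  obtains z where "x < z" "z < y" "slope a h y - slope a h x = (y - x) * curv a z"
  using MVT2[of x y "slope a h" "curv a"] DERIV_slope assms by fastforce

lemma free_energy_diff:
  assumes "0 < x" "x < y" "y < 1"
  obtains z where "x < z" "z < y" "free_energy a h y - free_energy a h x = (y - x) * slope a h z"
  using MVT2[of x y "free_energy a h" "slope a h"] DERIV_free_energy assms by fastforce

lemma maximizer_curv_nonpos: assumes u: "u \<in> maximizers a h" shows "curv a u \<le> 0"
proof (rule ccontr)
  note i = maximizer_interior[OF u]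
  assume "\<not> curv a u \<le> 0"
  then obtain d where d: "d > 0" "\<And>k. 0 < k \<Longrightarrow> k < d \<Longrightarrow> slope a h u < slope a h (u + k)"
    using DERIV_pos_inc_right[OF DERIV_slope[OF i, of a h]] by force
  define y where "y = u + min d (1 - u) / 2"
  have y: "u < y" "y < 1" "y - u < d" using d i by (auto simp: y_def min_def field_simps)
  obtain z where z: "u < z" "z < y" "free_energy a h y - free_energy a h u = (y - u) * slope a h z"
    using free_energy_diff i y by metis
  have "0 < slope a h z" using d(2)[of "z - u"] z y maximizer_slope[OF u] by auto
  then have "free_energy a h u < free_energy a h y" using z y by (metis diff_gt_0_iff_gt mult_pos_pos)
  then show False using u y i by (simp add: maximizers_iff not_le[symmetric])
qed

section \<open>Uniqueness and nondegeneracy of the maximizer\<close>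

text \<open>
  Multiplying by \<open>u * (1 - u)\<close> reduces the sign of the second derivative to the position of the
  cubic \<open>u\<^sup>2 * (1 - u)\<close> relative to \<open>1 / (2 * a)\<close>.
\<close>

lemma curv_sign:
  assumes "0 < u" "u < 1"
  shows "curv a u < 0 \<longleftrightarrow> 2 * a * (u\<^sup>2 * (1 - u)) < 1" "curv a u = 0 \<longleftrightarrow> 2 * a * (u\<^sup>2 * (1 - u)) = 1"
    "0 < curv a u \<longleftrightarrow> 1 < 2 * a * (u\<^sup>2 * (1 - u))"
proof -
  have e: "curv a u = (2 * a * (u\<^sup>2 * (1 - u)) - 1) / (u * (1 - u))"
    using assms by (simp add: curv_def field_simps power2_eq_square)
  have p: "0 < u * (1 - u)" using assms by simp
  show "curv a u < 0 \<longleftrightarrow> 2 * a * (u\<^sup>2 * (1 - u)) < 1" "curv a u = 0 \<longleftrightarrow> 2 * a * (u\<^sup>2 * (1 - u)) = 1"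
    "0 < curv a u \<longleftrightarrow> 1 < 2 * a * (u\<^sup>2 * (1 - u))"
    unfolding e using p by (auto simp: divide_less_0_iff zero_less_divide_iff)
qed

lemma cubic_increasing:
  fixes x y :: real assumes "0 < x" "x < y" "y \<le> 2/3"
  shows "x\<^sup>2 * (1 - x) < y\<^sup>2 * (1 - y)"
proof -
  have e: "y\<^sup>2 * (1 - y) - x\<^sup>2 * (1 - x) = (y - x) * (x + y - x * x - y * y - x * y)"
    by (simp add: power2_eq_square algebra_simps)
  have "x * x < 2/3 * x" "y * y \<le> 2/3 * y" using assms by (auto intro: mult_strict_right_mono mult_right_mono)
  moreover have "x * y \<le> 1/3 * (x + y)"
  proof -
    have "4 * (x * y) \<le> (x + y) * (x + y)" using zero_le_square[of "x - y"] by (simp add: algebra_simps)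
    also have "\<dots> \<le> 4/3 * (x + y)" using assms by (intro mult_right_mono) auto
    finally show ?thesis by simp
  qed
  ultimately have "0 < x + y - x * x - y * y - x * y" by (simp add: algebra_simps)
  then have "0 < y\<^sup>2 * (1 - y) - x\<^sup>2 * (1 - x)" unfolding e using assms by simp
  then show ?thesis by simp
qed

lemma cubic_decreasing:
  fixes x y :: real assumes "2/3 \<le> x" "x < y"
  shows "y\<^sup>2 * (1 - y) < x\<^sup>2 * (1 - x)"
proof -
  have e: "y\<^sup>2 * (1 - y) - x\<^sup>2 * (1 - x) = (y - x) * (x + y - x * x - y * y - x * y)"
    by (simp add: power2_eq_square algebra_simps)
  have "2/3 * x \<le> x * x" "2/3 * y < y * y" "2/3 * y \<le> x * y" using assms
    by (auto intro: mult_strict_right_mono mult_right_mono)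
  then have "x + y - x * x - y * y - x * y < 0" using assms by linarith
  then have "y\<^sup>2 * (1 - y) - x\<^sup>2 * (1 - x) < 0" unfolding e using assms by (simp add: mult_pos_neg)
  then show ?thesis by simp
qed

text \<open>
  Between two maximizers the slope has the same value at both ends, so the curvature vanishes at some
  \<open>z\<close> in between. If both were at most \<open>2/3\<close>, the cubic would be larger at the right one than at
  \<open>z\<close>, and the curvature there would be positive; symmetrically on the other side.
\<close>

lemma maximizers_separated:
  assumes u: "u \<in> maximizers a h" and v: "v \<in> maximizers a h" and "u < v"
  shows "u < 2/3" "2/3 < v"
proof -
  note iu = maximizer_interior[OF u] and iv = maximizer_interior[OF v]
  obtain z where z: "u < z" "z < v" "slope a h v - slope a h u = (v - u) * curv a z"
    using slope_diff iu iv assms(3) by metis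
  have c0: "curv a z = 0"
    using z maximizer_slope[OF u] maximizer_slope[OF v] assms(3) by simp
  have z01: "0 < z" "z < 1" using z iu iv by auto
  have cz: "2 * a * (z\<^sup>2 * (1 - z)) = 1" using curv_sign(2)[OF z01] c0 by simp
  have pz: "0 < z\<^sup>2 * (1 - z)" using z01 by simp
  have a: "0 < a"
  proof (rule ccontr)
    assume "\<not> 0 < a"
    then have "2 * a * (z\<^sup>2 * (1 - z)) \<le> 0" using pz by (intro mult_nonpos_nonneg[of "2 * a"]) (simp_all add: not_less)
    then show False using cz by simp
  qed
  have cu: "2 * a * (u\<^sup>2 * (1 - u)) \<le> 1" using maximizer_curv_nonpos[OF u] curv_sign(3)[OF iu, of a] by linarith
  have cv: "2 * a * (v\<^sup>2 * (1 - v)) \<le> 1" using maximizer_curv_nonpos[OF v] curv_sign(3)[OF iv, of a] by linarith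
  show "u < 2/3"
  proof (rule ccontr)
    assume "\<not> u < 2/3"
    then have "z\<^sup>2 * (1 - z) < u\<^sup>2 * (1 - u)" using cubic_decreasing z by simp
    then have "2 * a * (z\<^sup>2 * (1 - z)) < 2 * a * (u\<^sup>2 * (1 - u))" using a by simp
    then show False using cz cu by simp
  qed
  show "2/3 < v"
  proof (rule ccontr)
    assume "\<not> 2/3 < v"
    then have "z\<^sup>2 * (1 - z) < v\<^sup>2 * (1 - v)" using cubic_increasing z z01 by simp
    then have "2 * a * (z\<^sup>2 * (1 - z)) < 2 * a * (v\<^sup>2 * (1 - v))" using a by simp
    then show False using cz cv by simp
  qed
qed

text \<open>
  Adding the two optimality inequalities cancels everything except the linear term.
\<close>

lemma maximizers_mono:
  assumes "u \<in> maximizers a h" "v \<in> maximizers a k" "h < k"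
  shows "u \<le> v"
proof -
  have "free_energy a h v \<le> free_energy a h u" "free_energy a k u \<le> free_energy a k v"
    using assms by (auto simp: maximizers_iff)
  then have "(k - h) * u \<le> (k - h) * v" by (simp add: free_energy_def algebra_simps)
  then show ?thesis using assms by simp
qed

lemma cubic_less_peak:
  fixes z :: real assumes "0 < z" "z < 1" "z \<noteq> 2/3" shows "z\<^sup>2 * (1 - z) < 4/27"
  using assms cubic_increasing[of z "2/3"] cubic_decreasing[of "2/3" z]
  by (cases "z < 2/3") (auto simp: power2_eq_square)

lemma slope_critical_pos:
  assumes "0 < u" "u < 2/3" shows "0 < slope \<alpha>\<^sub>c h\<^sub>c u"
proof -
  obtain z where z: "u < z" "z < 2/3" "slope \<alpha>\<^sub>c h\<^sub>c (2/3) - slope \<alpha>\<^sub>c h\<^sub>c u = (2/3 - u) * curv \<alpha>\<^sub>c z"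
    using slope_diff[of u "2/3"] assms by auto
  have "curv \<alpha>\<^sub>c z < 0" using curv_sign(1)[of z \<alpha>\<^sub>c] cubic_less_peak[of z] z assms by (simp add: \<alpha>\<^sub>c_def)
  moreover have "slope \<alpha>\<^sub>c h\<^sub>c (2/3) = 0"
    by (simp add: slope_def \<alpha>\<^sub>c_def h\<^sub>c_def ln_div power2_eq_square)
  ultimately show ?thesis using z assms mult_pos_neg[of "2/3 - u" "curv \<alpha>\<^sub>c z"] by simp
qed

text \<open>
  For \<open>a \<le> \<alpha>\<^sub>c\<close> the curvature is negative except possibly at \<open>2/3\<close>, so the slope cannot vanish twice.
  For \<open>a > \<alpha>\<^sub>c\<close> and \<open>h \<ge> h\<^sub>c\<close> the slope dominates the one at the critical parameters, which is
  positive to the left of \<open>2/3\<close>; this excludes the lower maximizer.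
\<close>

lemma two_maximizers_supercritical:
  assumes u: "u \<in> maximizers a h" and v: "v \<in> maximizers a h" and "u < v"
  shows "\<alpha>\<^sub>c < a" "h < h\<^sub>c"
proof -
  note s = maximizers_separated[OF assms]
  note iu = maximizer_interior[OF u] and iv = maximizer_interior[OF v]
  show a: "\<alpha>\<^sub>c < a"
  proof (rule ccontr)
    assume na: "\<not> \<alpha>\<^sub>c < a"
    have neg: "curv a z < 0" if "0 < z" "z < 1" "z \<noteq> 2/3" for z
    proof -
      have "2 * a * (z\<^sup>2 * (1 - z)) \<le> 2 * \<alpha>\<^sub>c * (z\<^sup>2 * (1 - z))" using na that by (intro mult_right_mono) auto
      also have "\<dots> < 1" using cubic_less_peak[OF that] by (simp add: \<alpha>\<^sub>c_def)
      finally show ?thesis using curv_sign(1) that by simp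
    qed
    obtain z where z: "u < z" "z < 2/3" "slope a h (2/3) - slope a h u = (2/3 - u) * curv a z"
      using slope_diff[of u "2/3"] iu s by auto
    obtain y where y: "2/3 < y" "y < v" "slope a h v - slope a h (2/3) = (v - 2/3) * curv a y"
      using slope_diff[of "2/3" v] iv s by auto
    have "(2/3 - u) * curv a z < 0" "(v - 2/3) * curv a y < 0"
      using neg[of z] neg[of y] z y iu iv s by (auto intro!: mult_pos_neg)
    then show False using z y maximizer_slope[OF u] maximizer_slope[OF v] by linarith
  qed
  show "h < h\<^sub>c"
  proof (rule ccontr)
    assume "\<not> h < h\<^sub>c"
    moreover have "\<alpha>\<^sub>c * u\<^sup>2 \<le> a * u\<^sup>2" using a by (intro mult_right_mono) auto
    ultimately have "slope \<alpha>\<^sub>c h\<^sub>c u \<le> slope a h u" by (simp add: slope_def)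
    then show False using slope_critical_pos[of u] iu s maximizer_slope[OF u] by simp
  qed
qed

text \<open>
  If two maximizers existed for two values of \<open>h\<close>, monotonicity would place the upper one for the
  smaller value below the lower one for the larger value, although \<open>2/3\<close> separates them the other way.
\<close>

lemma two_maximizers_q_crit:
  assumes u: "u \<in> maximizers a h" and v: "v \<in> maximizers a h" and uv: "u < v"
  shows "q_crit a = h"
  unfolding q_crit_def
proof (rule the_equality)
  note s = maximizers_separated[OF assms]
  have "w = u \<or> w = v" if w: "w \<in> maximizers a h" for w
    using s maximizers_separated[OF w u] maximizers_separated[OF u w]
      maximizers_separated[OF w v] maximizers_separated[OF v w] by force
  then have "maximizers a h = {u, v}" using u v by blast
  then show "card (maximizers a h) = 2" using uv by simp
  fix k assume "card (maximizers a k) = 2"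
  then obtain x y where xy: "maximizers a k = {x, y}" "x \<noteq> y" by (meson card_2_iff)
  then have "\<exists>x y. x \<in> maximizers a k \<and> y \<in> maximizers a k \<and> x < y"
    by (metis insertCI linorder_neqE_linordered_idom)
  then obtain x y where xy: "x \<in> maximizers a k" "y \<in> maximizers a k" "x < y" by blast
  note s' = maximizers_separated[OF xy]
  show "k = h"
    using maximizers_mono[OF v xy(1)] maximizers_mono[OF xy(2) u] s s' by force
qed

lemma unique_maximizer:
  assumes "u \<in> maximizers a h" "v \<in> maximizers a h" "(a, h) \<notin> M_rs"
  shows "u = v"
  using assms two_maximizers_q_crit[of u a h v] two_maximizers_q_crit[of v a h u]
    two_maximizers_supercritical[of u a h v] two_maximizers_supercritical[of v a h u]
  by (force simp: M_rs_def)

lemma maximizers_eq_u_star: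
  assumes "(a, h) \<notin> M_rs" shows "maximizers a h = {u_star a h}"
proof -
  have "\<exists>!u. u \<in> maximizers a h" using ex_maximizer unique_maximizer assms by blast
  then show ?thesis unfolding u_star_def using theI'[of "\<lambda>u. u \<in> maximizers a h"] by blast
qed

text \<open>
  If the curvature vanished at a maximizer other than \<open>2/3\<close>, it would be positive all the way from there
  to \<open>2/3\<close>, and the free energy would be larger at \<open>2/3\<close>. If it vanishes at \<open>2/3\<close> itself, the
  equations for curvature and slope determine the critical parameters.
\<close>

lemma maximizer_nondegenerate:
  assumes u: "u \<in> maximizers a h" and "(a, h) \<noteq> (\<alpha>\<^sub>c, h\<^sub>c)"
  shows "curv a u < 0"
proof (rule ccontr)
  note iu = maximizer_interior[OF u] and su = maximizer_slope[OF u]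
  assume "\<not> curv a u < 0"
  then have "curv a u = 0" using maximizer_curv_nonpos[OF u] by simp
  then have c: "2 * a * (u\<^sup>2 * (1 - u)) = 1" using curv_sign(2)[OF iu] by simp
  have a: "0 < a"
  proof (rule ccontr)
    assume "\<not> 0 < a"
    then have "2 * a * (u\<^sup>2 * (1 - u)) \<le> 0" using iu by (intro mult_nonpos_nonneg[of "2 * a"]) (simp_all add: not_less)
    then show False using c by simp
  qed
  have pos: "0 < curv a z" if "0 < z" "z < 1" "u\<^sup>2 * (1 - u) < z\<^sup>2 * (1 - z)" for z
  proof -
    have "2 * a * (u\<^sup>2 * (1 - u)) < 2 * a * (z\<^sup>2 * (1 - z))" using a that by simp
    then show ?thesis using c curv_sign(3) that by simp
  qed
  have m: "free_energy a h (2/3) \<le> free_energy a h u" using u by (auto simp: maximizers_iff)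
  consider "u < 2/3" | "2/3 < u" | "u = 2/3" by linarith
  then show False
  proof cases
    case 1
    obtain z where z: "u < z" "z < 2/3" "free_energy a h (2/3) - free_energy a h u = (2/3 - u) * slope a h z"
      using free_energy_diff[of u "2/3"] 1 iu by auto
    obtain y where y: "u < y" "y < z" "slope a h z - slope a h u = (z - u) * curv a y"
      using slope_diff[of u z] z iu by auto
    have "0 < curv a y" using pos[of y] cubic_increasing[of u y] y z iu by auto
    then have "0 < (z - u) * curv a y" using z by simp
    then have "0 < (2/3 - u) * slope a h z" using y su 1 by simp
    then show False using z m by linarith
  next
    case 2
    obtain z where z: "2/3 < z" "z < u" "free_energy a h u - free_energy a h (2/3) = (u - 2/3) * slope a h z"
      using free_energy_diff[of "2/3" u] 2 iu by auto
    obtain y where y: "z < y" "y < u" "slope a h u - slope a h z = (u - z) * curv a y"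
      using slope_diff[of z u] z iu by auto
    have "0 < curv a y" using pos[of y] cubic_decreasing[of y u] y z iu by auto
    then have "0 < (u - z) * curv a y" using z by simp
    then have "(u - 2/3) * slope a h z < 0" using y su 2 by (simp add: mult_pos_neg)
    then show False using z m by linarith
  next
    case 3
    then have "u = 2/3" by simp
    then have "a = \<alpha>\<^sub>c" using c unfolding \<open>u = 2/3\<close> by (simp add: \<alpha>\<^sub>c_def power2_eq_square)
    moreover from this have "h = h\<^sub>c" using su 3
      by (simp add: slope_def \<alpha>\<^sub>c_def h\<^sub>c_def ln_div power2_eq_square)
    ultimately show False using assms by simp
  qed
qed

text \<open>
  The quotient by \<open>(v - u)\<^sup>2\<close> extends continuously to \<open>u\<close> by l'Hopital's rule; it is negative elsewhere by
  uniqueness of the maximizer and at \<open>u\<close> by nondegeneracy. This single function carries both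
  the local expansion at \<open>u\<close> and, by compactness, the global quadratic bound.
\<close>

lemma quadratic_factor:
  assumes max: "maximizers a h = {u}" and c: "curv a u < 0"
  obtains q where "continuous_on {0..1} q" "\<And>v. v \<in> {0..1} \<Longrightarrow> q v < 0" "q u = curv a u / 2"
    "\<And>v. v \<in> {0..1} \<Longrightarrow> free_energy a h v = free_energy a h u + q v * (v - u)\<^sup>2"
proof
  have u: "u \<in> maximizers a h" using max by simp
  note iu = maximizer_interior[OF u] and su = maximizer_slope[OF u]
  let ?F = "free_energy a h"
  define q where "q = (\<lambda>v. if v = u then curv a u / 2 else (?F v - ?F u) / (v - u)\<^sup>2)"
  have near: "\<forall>\<^sub>F v in at u. 0 < v \<and> v < 1"
    using iu by (intro eventually_at_in_open'[of "{0<..<1}", simplified]) auto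
  have l1: "((\<lambda>v. slope a h v / (2 * (v - u))) \<longlongrightarrow> curv a u / 2) (at u)"
  proof -
    have "((\<lambda>v. (slope a h v - slope a h u) / (v - u)) \<longlongrightarrow> curv a u) (at u)"
      using DERIV_slope[OF iu] by (simp add: has_field_derivative_iff)
    then have "((\<lambda>v. (slope a h v - slope a h u) / (v - u) / 2) \<longlongrightarrow> curv a u / 2) (at u)"
      by (intro tendsto_intros) auto
    then show ?thesis using su by (simp add: mult.commute)
  qed
  have "((\<lambda>v. (?F v - ?F u) / (v - u)\<^sup>2) \<longlongrightarrow> curv a u / 2) (at u)"
  proof (rule lhopital)
    show "((\<lambda>v. ?F v - ?F u) \<longlongrightarrow> 0) (at u)"
      using DERIV_isCont[OF DERIV_free_energy[OF iu]] by (simp add: isCont_def LIM_zero)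
    show "((\<lambda>v. (v - u)\<^sup>2) \<longlongrightarrow> 0) (at u)" by (auto intro!: tendsto_eq_intros)
    show "\<forall>\<^sub>F v in at u. (v - u)\<^sup>2 \<noteq> 0" by (auto simp: eventually_at_filter)
    show "\<forall>\<^sub>F v in at u. 2 * (v - u) \<noteq> 0" by (auto simp: eventually_at_filter)
    show "\<forall>\<^sub>F v in at u. ((\<lambda>v. ?F v - ?F u) has_real_derivative slope a h v) (at v)"
      using near by eventually_elim (auto intro!: derivative_eq_intros DERIV_free_energy)
    show "\<forall>\<^sub>F v in at u. ((\<lambda>v. (v - u)\<^sup>2) has_real_derivative 2 * (v - u)) (at v)"
      by (intro always_eventually allI) (auto intro!: derivative_eq_intros)
  qed (rule l1)
  moreover have "\<forall>\<^sub>F v in at u. (?F v - ?F u) / (v - u)\<^sup>2 = q v"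
    by (auto simp: q_def eventually_at_filter)
  ultimately have "(q \<longlongrightarrow> q u) (at u)"
    using Lim_transform_eventually by (simp add: q_def)
  then have cont_u: "isCont q u" by (simp add: isCont_def)
  show "continuous_on {0..1} q"
    unfolding continuous_on_eq_continuous_within
  proof
    fix v :: real assume v: "v \<in> {0..1}"
    show "continuous (at v within {0..1}) q"
    proof (cases "v = u")
      case True then show ?thesis using cont_u continuous_at_imp_continuous_at_within by blast
    next
      case False
      have "continuous (at v within {0..1}) (\<lambda>v. (?F v - ?F u) / (v - u)\<^sup>2)"
        using v False continuous_on_free_energy
        by (intro continuous_intros) (auto simp: continuous_on_eq_continuous_within)
      moreover have "\<forall>\<^sub>F w in at v within {0..1}. w \<noteq> u"
        using False by (metis eventually_neq_at_within)
      then have "\<forall>\<^sub>F w in at v within {0..1}. (?F w - ?F u) / (w - u)\<^sup>2 = q w"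
        by eventually_elim (simp add: q_def)
      moreover have "(?F v - ?F u) / (v - u)\<^sup>2 = q v" using False by (simp add: q_def)
      ultimately show ?thesis
        unfolding continuous_within by (simp add: Lim_transform_eventually)
    qed
  qed
  show "q v < 0" if v: "v \<in> {0..1}" for v
  proof (cases "v = u")
    case True then show ?thesis using c by (simp add: q_def)
  next
    case False
    then have "v \<notin> maximizers a h" using max by simp
    then obtain w where "w \<in> {0..1}" "?F v < ?F w" using v by (auto simp: maximizers_iff not_le)
    moreover have "?F w \<le> ?F u" using u \<open>w \<in> _\<close> by (auto simp: maximizers_iff)
    ultimately show ?thesis using False by (simp add: q_def divide_less_0_iff)
  qed
  show "q u = curv a u / 2" by (simp add: q_def)
  show "?F v = ?F u + q v * (v - u)\<^sup>2" for v by (simp add: q_def)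
qed

lemma quadratic_bound:
  assumes "maximizers a h = {u}" and "curv a u < 0"
  obtains c where "0 < c" "\<And>v. v \<in> {0..1} \<Longrightarrow> free_energy a h v \<le> free_energy a h u - c * (v - u)\<^sup>2"
proof -
  obtain q where q: "continuous_on {0..1} q" "\<And>v. v \<in> {0..1} \<Longrightarrow> q v < 0"
    "\<And>v. v \<in> {0..1} \<Longrightarrow> free_energy a h v = free_energy a h u + q v * (v - u)\<^sup>2"
    using quadratic_factor[OF assms] by metis
  obtain w where w: "w \<in> {0..1}" "\<And>v. v \<in> {0..1} \<Longrightarrow> q v \<le> q w"
    using continuous_attains_sup[OF _ _ q(1)] by auto
  show ?thesis
  proof
    show "0 < - q w" using q(2) w(1) by simp
    fix v :: real assume v: "v \<in> {0..1}"
    have "q v * (v - u)\<^sup>2 \<le> q w * (v - u)\<^sup>2" using w(2)[OF v] by (intro mult_right_mono) auto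
    then show "free_energy a h v \<le> free_energy a h u - (- q w) * (v - u)\<^sup>2" using q(3)[OF v] by simp
  qed
qed

text \<open>
  The maximizer inverts \<open>u \<mapsto> - slope a 0 u\<close>, whose derivative is \<open>- curv a u\<close>. Continuity in \<open>h\<close> comes
  from the quadratic bound: passing from \<open>h\<close> to \<open>t\<close> changes the free energy by a linear term only,
  which moves the maximizer by at most a multiple of \<open>\<bar>t - h\<bar>\<close>.
\<close>

lemma DERIV_u_star:
  assumes "(a, h) \<notin> M_rs" "(a, h) \<noteq> (\<alpha>\<^sub>c, h\<^sub>c)"
  shows "((\<lambda>t. u_star a t) has_real_derivative - 1 / curv a (u_star a h)) (at h)"
proof -
  define u where "u = u_star a h"
  have max: "maximizers a h = {u}" using maximizers_eq_u_star[OF assms(1)] by (simp add: u_def)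
  then have mu: "u \<in> maximizers a h" by simp
  note iu = maximizer_interior[OF mu]
  have c: "curv a u < 0" using maximizer_nondegenerate[OF mu assms(2)] .
  obtain r where r: "0 < r" "\<And>t. \<bar>t - h\<bar> < r \<Longrightarrow> (a, t) \<notin> M_rs"
  proof
    \<comment> \<open>On the line of fixed \<open>a\<close> the critical curve has the single point \<open>q_crit a\<close>.
      If that point is \<open>h\<close>, it is excluded by assumption and every radius will do.\<close>
    let ?r = "if q_crit a = h then 1 else \<bar>q_crit a - h\<bar>"
    show "0 < ?r" by simp
    show "(a, t) \<notin> M_rs" if "\<bar>t - h\<bar> < ?r" for t
      using that assms(1) by (auto simp: M_rs_def split: if_splits)
  qed
  have mem: "u_star a t \<in> maximizers a t" if "\<bar>t - h\<bar> < r" for t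
    using maximizers_eq_u_star r(2)[OF that] by simp
  obtain k where k: "0 < k" "\<And>v. v \<in> {0..1} \<Longrightarrow> free_energy a h v \<le> free_energy a h u - k * (v - u)\<^sup>2"
    using quadratic_bound[OF max c] by blast
  have lip: "\<bar>u_star a t - u\<bar> \<le> \<bar>t - h\<bar> / k" if t: "\<bar>t - h\<bar> < r" for t
  proof (cases "u_star a t = u")
    case False
    define v where "v = u_star a t"
    have v: "v \<in> {0..1}" "free_energy a t u \<le> free_energy a t v"
      using mem[OF t] iu unfolding v_def maximizers_iff by auto
    have "k * (v - u)\<^sup>2 \<le> (t - h) * (v - u)"
      using k(2)[OF v(1)] v(2) by (simp add: free_energy_def algebra_simps)
    also have "\<dots> \<le> \<bar>t - h\<bar> * \<bar>v - u\<bar>" by (metis abs_ge_self abs_mult)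
    finally have "k * \<bar>v - u\<bar> * \<bar>v - u\<bar> \<le> \<bar>t - h\<bar> * \<bar>v - u\<bar>"
      by (simp add: power2_eq_square mult.assoc flip: abs_mult)
    then have "k * \<bar>v - u\<bar> \<le> \<bar>t - h\<bar>" using False by (simp add: v_def)
    then show ?thesis using k(1) by (simp add: v_def field_simps)
  qed (use k in auto)
  have cont: "isCont (u_star a) h"
  proof -
    have "((\<lambda>t. u_star a t - u) \<longlongrightarrow> 0) (at h)"
    proof (rule Lim_null_comparison)
      show "\<forall>\<^sub>F t in at h. norm (u_star a t - u) \<le> \<bar>t - h\<bar> / k"
        unfolding eventually_at using r(1) lip by (auto simp: dist_real_def)
      show "((\<lambda>t. \<bar>t - h\<bar> / k) \<longlongrightarrow> 0) (at h)" using k(1) by (auto intro!: tendsto_eq_intros)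
    qed
    then show ?thesis by (simp add: isCont_def u_def LIM_zero_iff)
  qed
  have "((u_star a) has_real_derivative inverse (- curv a u)) (at h)"
  proof (rule DERIV_inverse_function[where f = "\<lambda>x. - slope a 0 x" and a = "h - r" and b = "h + r"])
    show "((\<lambda>x. - slope a 0 x) has_real_derivative - curv a u) (at (u_star a h))"
      using iu by (auto intro!: derivative_eq_intros DERIV_slope simp: u_def)
    show "- slope a 0 (u_star a y) = y" if "h - r < y" "y < h + r" for y
      using maximizer_slope[OF mem[of y]] that by (auto simp: slope_def abs_less_iff)
  qed (use c r cont in auto)
  then show ?thesis by (simp add: u_def field_simps)
qed

section \<open>Binomial coefficients and the entropy\<close>

definition scaled_entropy :: "nat \<Rightarrow> real \<Rightarrow> real" where
  "scaled_entropy N x = real (Suc N) * entropy_fun (x / real (Suc N))"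

text \<open>
  The increment equals \<open>ln ((N - j) / (j + 1))\<close>, which is exactly minus the derivative of \<open>B\<close> at \<open>j + 1\<close> when
  the entropy is scaled by \<open>N + 1\<close> instead of \<open>N\<close>. As \<open>B\<close> is convex, the value lies between the
  differences over the two adjacent unit intervals.
\<close>

lemma choose_log_step:
  fixes j N :: nat and B :: "real \<Rightarrow> real"
  defines "B \<equiv> scaled_entropy N"
  assumes "j < N"
  shows "B (real j + 1) - B (real j + 2) \<le> ln (real (N choose Suc j)) - ln (real (N choose j))"
    and "ln (real (N choose Suc j)) - ln (real (N choose j)) \<le> B (real j) - B (real j + 1)"
proof -
  let ?T = "real (Suc N)"
  have DB: "(B has_real_derivative ln x - ln (?T - x)) (at x)" if "0 < x" "x < ?T" for x
  proof -
    have "(B has_real_derivative ?T * ((ln (x / ?T) - ln (1 - x / ?T)) * (1 / ?T))) (at x)"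
      unfolding B_def scaled_entropy_def[abs_def] using that
      by (intro DERIV_cmult DERIV_chain2[OF DERIV_entropy] DERIV_cdivide DERIV_ident) (auto simp: field_simps)
    moreover have "ln (x / ?T) - ln (1 - x / ?T) = ln x - ln (?T - x)"
    proof -
      have "1 - x / ?T = (?T - x) / ?T" by (simp add: field_simps)
      then show ?thesis using that by (simp add: ln_div)
    qed
    ultimately show ?thesis by simp
  qed
  have cont: "continuous_on {x..y} B" if "0 \<le> x" "y \<le> ?T" for x y
    unfolding B_def scaled_entropy_def[abs_def] using that
    by (intro continuous_intros continuous_on_compose2[OF continuous_on_entropy]) auto
  have inc: "\<exists>z. x < z \<and> z < x + 1 \<and> B x - B (x + 1) = ln (?T - z) - ln z"
    if x: "0 \<le> x" "x + 1 \<le> ?T" for x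
  proof -
    have D: "(B has_derivative (*) (ln z - ln (?T - z))) (at z)" if "x < z" "z < x + 1" for z
      using DB[of z] that x by (simp add: has_field_derivative_def)
    obtain z where z: "x < z" "z < x + 1" "B (x + 1) - B x = (ln z - ln (?T - z)) * (x + 1 - x)"
      by (rule mvt[of x "x + 1" B "\<lambda>z. (*) (ln z - ln (?T - z))"]) (use cont x D in auto)
    then show ?thesis by (intro exI[of _ z]) simp
  qed
  obtain m where "N = Suc (j + m)" using less_imp_Suc_add[OF assms(2)] by blast
  then have "real (Suc j * (N choose Suc j)) = real ((N - j) * (N choose j))"
    using Suc_times_binomial_add[of j m] by (simp add: Suc_diff_le)
  then have "ln (real (Suc j)) + ln (real (N choose Suc j)) = ln (real (N - j)) + ln (real (N choose j))"
  proof -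
    have "0 < N choose Suc j" "0 < N choose j" "0 < N - j" using assms(2) by (auto simp: zero_less_binomial)
    then have "ln (real (Suc j * (N choose Suc j))) = ln (real (Suc j)) + ln (real (N choose Suc j))"
      "ln (real ((N - j) * (N choose j))) = ln (real (N - j)) + ln (real (N choose j))"
      unfolding of_nat_mult by (auto intro!: ln_mult_pos simp del: of_nat_Suc of_nat_diff)
    then show ?thesis using \<open>real (Suc j * _) = _\<close> by simp
  qed
  then have step: "ln (real (N choose Suc j)) - ln (real (N choose j)) = ln (?T - (real j + 1)) - ln (real j + 1)"
    using assms(2) by (simp add: of_nat_diff algebra_simps)
  obtain z where z: "real j < z" "z < real j + 1" "B (real j) - B (real j + 1) = ln (?T - z) - ln z"
    using inc[of "real j"] assms(2) by auto
  show "ln (real (N choose Suc j)) - ln (real (N choose j)) \<le> B (real j) - B (real j + 1)"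
    unfolding step z(3) using z(1,2) assms(2) by (intro diff_mono) auto
  obtain z where z: "real j + 1 < z" "z < real j + 2" "B (real j + 1) - B (real j + 2) = ln (?T - z) - ln z"
    using inc[of "real j + 1"] assms(2) by (auto simp: add.assoc)
  show "B (real j + 1) - B (real j + 2) \<le> ln (real (N choose Suc j)) - ln (real (N choose j))"
    unfolding step z(3) using z(1,2) assms(2) by (intro diff_mono) auto
qed

lemma choose_log_bounds_up:
  fixes j k N :: nat and B :: "real \<Rightarrow> real"
  defines "B \<equiv> scaled_entropy N"
  assumes "j \<le> k" "k \<le> N"
  shows "B (real j + 1) - B (real k + 1) \<le> ln (real (N choose k)) - ln (real (N choose j))
    \<and> ln (real (N choose k)) - ln (real (N choose j)) \<le> B (real j) - B (real k)"
  using assms(2,3)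
proof (induction k rule: dec_induct)
  case base then show ?case by simp
next
  case (step i)
  have e: "real i + 2 = real (Suc i) + 1" "real i + 1 = real (Suc i)" by simp_all
  have "B (real i + 1) - B (real (Suc i) + 1) \<le> ln (real (N choose Suc i)) - ln (real (N choose i))"
    using choose_log_step(1)[of i N, folded B_def] step unfolding e(1) by simp
  moreover have "ln (real (N choose Suc i)) - ln (real (N choose i)) \<le> B (real i) - B (real (Suc i))"
    using choose_log_step(2)[of i N, folded B_def] step unfolding e(2) by simp
  ultimately show ?case using step by auto
qed

text \<open>
  A sharp substitute for Stirling's formula: the steps telescope, and no prefactor polynomial in \<open>N\<close> is
  lost.
\<close>

lemma choose_log_sandwich:
  fixes j k N :: nat and B :: "real \<Rightarrow> real"
  defines "B \<equiv> scaled_entropy N"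
  assumes "j \<le> N" "k \<le> N"
  shows "min (B (real j) - B (real k)) (B (real j + 1) - B (real k + 1))
      \<le> ln (real (N choose k)) - ln (real (N choose j))"
    and "ln (real (N choose k)) - ln (real (N choose j))
      \<le> max (B (real j) - B (real k)) (B (real j + 1) - B (real k + 1))"
  using choose_log_bounds_up[of j k N, folded B_def] choose_log_bounds_up[of k j N, folded B_def] assms(2,3)
  unfolding min_def max_def by (cases "j \<le> k"; fastforce)+

section \<open>The weights of the edge count\<close>

text \<open>
  One more than the number of edges: on this scale the increments of the logarithms of the binomial
  coefficients are exact values of the derivative of the entropy, see \<open>choose_log_step\<close>.
\<close>

definition lattice_size :: "nat \<Rightarrow> real" where
  "lattice_size n = real (Suc (card (edges n)))"

definition weight :: "nat \<Rightarrow> real \<Rightarrow> real \<Rightarrow> nat \<Rightarrow> real" where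
  "weight n a h k = real (card (edges n) choose k) * exp (4 * a / (3 * real n ^ 4) * real k ^ 3 + h * real k)"

text \<open>
  The coupling constant that appears when \<open>k\<close> is measured in units of \<open>lattice_size n\<close> instead of
  \<open>n\<^sup>2 / 2\<close>: \<open>4 * a / (3 * n ^ 4) * k ^ 3 = T * (coupling a n / 3) * (k / T) ^ 3\<close> for \<open>T = lattice_size n\<close>.
\<close>

definition coupling :: "real \<Rightarrow> nat \<Rightarrow> real" where
  "coupling a n = 4 * a * (lattice_size n)\<^sup>2 / real n ^ 4"

lemma weight_pos: "k \<le> card (edges n) \<Longrightarrow> 0 < weight n a h k"
  by (simp add: weight_def zero_less_binomial)

lemma card_edges: "card (edges n) = n choose 2"
  unfolding edges_def using n_subsets[of "{1..n}" 2] by simp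

lemma lattice_size_eq: "lattice_size n = (real n ^ 2 - real n + 2) / 2"
proof -
  have "real (n choose 2) = real n * (real n - 1) / 2"
    by (cases n) (simp_all add: choose_two real_of_nat_div algebra_simps)
  then show ?thesis by (simp add: lattice_size_def card_edges field_simps power2_eq_square)
qed

lemma lattice_size_ge_1: "1 \<le> lattice_size n" by (simp add: lattice_size_def)

lemma lattice_size_at_top: "filterlim lattice_size at_top sequentially"
  unfolding lattice_size_eq[abs_def] by real_asymp

lemma size_ratio: "(\<lambda>n. 2 * lattice_size n / real n ^ 2) \<longlonglongrightarrow> 1"
  unfolding lattice_size_eq by real_asymp

lemma coupling_eq: "coupling a n = a * (2 * lattice_size n / real n ^ 2)\<^sup>2"
  by (simp add: coupling_def power_divide power_mult_distrib flip: power_mult)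

lemma coupling_tendsto: "coupling a \<longlonglongrightarrow> a"
proof -
  have "(\<lambda>n. a * (2 * lattice_size n / real n ^ 2)\<^sup>2) \<longlonglongrightarrow> a * 1\<^sup>2"
    by (intro tendsto_intros size_ratio)
  then show ?thesis by (simp add: coupling_eq[abs_def])
qed

lemma sqrt_size_ratio: "(\<lambda>n. sqrt 2 * sqrt (lattice_size n) / real n) \<longlonglongrightarrow> 1"
proof -
  have "(\<lambda>n. sqrt (2 * lattice_size n / real n ^ 2)) \<longlonglongrightarrow> sqrt 1" by (intro tendsto_intros size_ratio)
  then show ?thesis by (simp add: real_sqrt_divide real_sqrt_mult)
qed

text \<open>
  The coupling differs from \<open>a\<close> by about \<open>- 2 * a / n\<close>. On the scale \<open>sqrt T\<close> this is a nonvanishing force,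
  which displaces the centre of the Gaussian profile.
\<close>

lemma coupling_shift: "(\<lambda>n. (coupling a n - a) * sqrt (lattice_size n)) \<longlonglongrightarrow> - sqrt 2 * a"
proof -
  let ?z = "\<lambda>n. 2 * lattice_size n / real n ^ 2"
  have "(\<lambda>n. real n * (?z n - 1)) \<longlonglongrightarrow> -1" unfolding lattice_size_eq by real_asymp
  then have "(\<lambda>n. a / sqrt 2 * (real n * (?z n - 1)) * (?z n + 1) * (sqrt 2 * sqrt (lattice_size n) / real n))
      \<longlonglongrightarrow> a / sqrt 2 * (-1) * (1 + 1) * 1"
    by (intro tendsto_intros size_ratio sqrt_size_ratio)
  moreover have "\<forall>\<^sub>F n in sequentially. a / sqrt 2 * (real n * (?z n - 1)) * (?z n + 1) * (sqrt 2 * sqrt (lattice_size n) / real n)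
      = (coupling a n - a) * sqrt (lattice_size n)"
    using eventually_gt_at_top[of 0]
  proof eventually_elim
    case (elim n)
    define z where "z = ?z n"
    have "a / sqrt 2 * (real n * (z - 1)) * (z + 1) * (sqrt 2 * sqrt (lattice_size n) / real n)
        = a * ((z - 1) * (z + 1)) * sqrt (lattice_size n)"
      using elim by simp
    also have "\<dots> = (a * z\<^sup>2 - a) * sqrt (lattice_size n)" by (simp add: algebra_simps power2_eq_square)
    finally show ?case by (simp add: coupling_eq z_def)
  qed
  ultimately have "(\<lambda>n. (coupling a n - a) * sqrt (lattice_size n)) \<longlonglongrightarrow> a / sqrt 2 * (-1) * (1 + 1) * 1"
    by (rule Lim_transform_eventually)
  moreover have "a / sqrt 2 * (-1) * (1 + 1) * 1 = - sqrt 2 * a"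
    by (simp add: field_simps)
  ultimately show ?thesis by metis
qed

text \<open>
  The exponent of the weight of \<open>k\<close> with the logarithm of the binomial coefficient replaced by minus the scaled
  entropy at \<open>k + s\<close>; the shifts \<open>s = 0\<close> and \<open>s = 1\<close> are the two sides of the sandwich.
\<close>

definition entropic_exponent :: "real \<Rightarrow> real \<Rightarrow> nat \<Rightarrow> real \<Rightarrow> nat \<Rightarrow> real" where
  "entropic_exponent a h n s k = 4 * a / (3 * real n ^ 4) * real k ^ 3 + h * real k
     - lattice_size n * entropy_fun ((real k + s) / lattice_size n)"

lemma log_weight_sandwich:
  fixes a h :: real and j k n :: nat
  assumes "j \<le> card (edges n)" "k \<le> card (edges n)"
  defines "D \<equiv> (\<lambda>s. entropic_exponent a h n s k - entropic_exponent a h n s j)"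
  shows "min (D 0) (D 1) \<le> ln (weight n a h k / weight n a h j)"
    "ln (weight n a h k / weight n a h j) \<le> max (D 0) (D 1)"
proof -
  let ?N = "card (edges n)"
  let ?g = "\<lambda>k. 4 * a / (3 * real n ^ 4) * real k ^ 3 + h * real k"
  have "ln (weight n a h k / weight n a h j) = ln (weight n a h k) - ln (weight n a h j)"
    using weight_pos[OF assms(1), of a h] weight_pos[OF assms(2), of a h] by (simp add: ln_div)
  also have "\<dots> = (ln (real (?N choose k)) - ln (real (?N choose j))) + (?g k - ?g j)"
    using assms unfolding weight_def by (subst (1 2) ln_mult) (auto simp: zero_less_binomial)
  finally have e: "ln (weight n a h k / weight n a h j) = \<dots>" .
  have D: "D s = (scaled_entropy ?N (real j + s) - scaled_entropy ?N (real k + s)) + (?g k - ?g j)" for s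
    by (simp add: D_def entropic_exponent_def scaled_entropy_def lattice_size_def)
  show "min (D 0) (D 1) \<le> ln (weight n a h k / weight n a h j)"
    "ln (weight n a h k / weight n a h j) \<le> max (D 0) (D 1)"
    unfolding e D using choose_log_sandwich[OF assms(1,2)] by (auto simp: min_def max_def split: if_splits)
qed

text \<open>
  The entropy is shifted by \<open>s\<close> while the interaction is not. The last two terms correct for this, and
  the second one for the difference between the coupling and \<open>a\<close>.
\<close>

lemma entropic_exponent_eq:
  fixes n k and s :: real
  defines "T \<equiv> lattice_size n" defines "p \<equiv> (real k + s) / T"
  shows "entropic_exponent a h n s k = T * free_energy a h p + T * (coupling a n - a) / 3 * p ^ 3
     - h * s - coupling a n / (3 * T\<^sup>2) * ((real k + s) ^ 3 - real k ^ 3)"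
proof -
  have T: "T > 0" using lattice_size_ge_1[of n] by (simp add: T_def)
  have e1: "coupling a n / (3 * T\<^sup>2) = 4 * a / (3 * real n ^ 4)"
    using T by (simp add: coupling_def T_def)
  have e2: "T * free_energy a h p = T * a / 3 * p ^ 3 + h * (real k + s) - T * entropy_fun p"
  proof -
    have "real k + s = T * p" using T by (simp add: p_def)
    then show ?thesis by (simp add: free_energy_def algebra_simps)
  qed
  have e3: "T * coupling a n / 3 * p ^ 3 = coupling a n / (3 * T\<^sup>2) * (real k + s) ^ 3"
    using T by (simp add: p_def field_simps power3_eq_cube power2_eq_square)
  have e4: "T * (coupling a n - a) / 3 * p ^ 3 = T * coupling a n / 3 * p ^ 3 - T * a / 3 * p ^ 3"
    by (simp add: algebra_simps diff_divide_distrib)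
  show ?thesis
    unfolding entropic_exponent_def T_def[symmetric] p_def[symmetric] e1[symmetric]
      right_diff_distrib[of "coupling a n / (3 * T\<^sup>2)"]
    using e2 e3 e4 unfolding distrib_left[of h] by linarith
qed

section \<open>The Gaussian profile of the weights\<close>

locale nondegenerate_maximizer =
  fixes a h u :: real
  assumes unique_max: "maximizers a h = {u}" and nondegenerate: "curv a u < 0"
begin

lemma u_interior: "0 < u" "u < 1"
  using maximizer_interior[of u a h] unique_max by auto

definition dev :: "nat \<Rightarrow> nat \<Rightarrow> real" where
  "dev n k = (real k - lattice_size n * u) / sqrt (lattice_size n)"

text \<open>
  The weights are normalized at this lattice point, which is at distance less than \<open>1\<close> from the
  rescaled maximizer \<open>T * u\<close>.
\<close>

definition base_point :: "nat \<Rightarrow> nat" where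
  "base_point n = nat \<lfloor>lattice_size n * u\<rfloor>"

lemma sqrt_size_ge_1: "1 \<le> sqrt (lattice_size n)"
  using lattice_size_ge_1 by simp

lemma base_point_le: "base_point n \<le> card (edges n)"
proof -
  have "lattice_size n * u < lattice_size n" using u_interior lattice_size_ge_1[of n] by simp
  then have "\<lfloor>lattice_size n * u\<rfloor> < int (Suc (card (edges n)))" by (simp add: lattice_size_def floor_less_iff)
  then show ?thesis by (simp add: base_point_def)
qed

lemma dev_base_point: "\<bar>dev n (base_point n)\<bar> \<le> 1 / sqrt (lattice_size n)" "dev n (base_point n) \<le> 0"
proof -
  have "0 \<le> lattice_size n * u" using u_interior lattice_size_ge_1[of n] by simp
  then have "real (base_point n) = real_of_int \<lfloor>lattice_size n * u\<rfloor>" by (simp add: base_point_def)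
  then have l: "real (base_point n) - lattice_size n * u \<le> 0" "- 1 \<le> real (base_point n) - lattice_size n * u" by linarith+
  then have "\<bar>real (base_point n) - lattice_size n * u\<bar> \<le> 1" by linarith
  then have "\<bar>real (base_point n) - lattice_size n * u\<bar> / sqrt (lattice_size n) \<le> 1 / sqrt (lattice_size n)"
    using sqrt_size_ge_1[of n] by (intro divide_right_mono) auto
  then show "\<bar>dev n (base_point n)\<bar> \<le> 1 / sqrt (lattice_size n)" "dev n (base_point n) \<le> 0"
    using sqrt_size_ge_1[of n] l by (auto simp: dev_def abs_divide divide_le_0_iff)
qed

lemma dev_le_1: "\<bar>dev n (base_point n)\<bar> \<le> 1"
  using dev_base_point(1)[of n] sqrt_size_ge_1[of n] by (meson order_trans divide_le_eq_1_pos less_le_trans zero_less_one)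

lemma shifted_fraction:
  assumes "k \<le> card (edges n)" "s \<in> {0, 1}"
  shows "(real k + s) / lattice_size n \<in> {0..1}"
  using assms by (auto simp: lattice_size_def)

lemma dev_shift: "sqrt (lattice_size n) * ((real k + s) / lattice_size n - u) = dev n k + s / sqrt (lattice_size n)"
proof -
  define R where "R = sqrt (lattice_size n)"
  have R: "R > 0" "lattice_size n = R * R" using lattice_size_ge_1[of n] by (auto simp: R_def)
  show ?thesis using R(1) unfolding dev_def R_def[symmetric] R(2) by (simp add: field_simps)
qed

text \<open>
  The three lines are the free energy, which yields the quadratic form in \<open>y\<close>; the shift of the coupling, which
  contributes the drift; and the mismatch between shifted and unshifted interaction, which vanishes in the limit.
\<close>

lemma entropic_exponent_diff:
  fixes n k and s :: real
  assumes "s \<in> {0, 1}"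
  defines "R \<equiv> sqrt (lattice_size n)" and "F \<equiv> free_energy a h"
    and "p \<equiv> (real k + s) / lattice_size n" and "p0 \<equiv> (real (base_point n) + s) / lattice_size n"
    and "y \<equiv> dev n k" and "y0 \<equiv> dev n (base_point n)"
  shows "entropic_exponent a h n s k - entropic_exponent a h n s (base_point n) =
     R\<^sup>2 * (F p - F u) - R\<^sup>2 * (F p0 - F u)
     + R * (coupling a n - a) / 3 * ((y - y0) * (p\<^sup>2 + p * p0 + p0\<^sup>2))
     - s * (coupling a n * ((y - y0) / R) * ((real k + real (base_point n) + 1) / lattice_size n))"
proof -
  have R: "R > 0" "lattice_size n = R\<^sup>2" using lattice_size_ge_1[of n] by (auto simp: R_def)
  have yd: "R * (y - y0) = real k - real (base_point n)"
    using R by (simp add: y_def y0_def dev_def R_def[symmetric] field_simps)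
  have "R * (p - p0) = y - y0"
    using dev_shift[of n k s] dev_shift[of n "base_point n" s]
    by (simp add: p_def p0_def y_def y0_def R_def algebra_simps)
  then have A: "R\<^sup>2 * (coupling a n - a) / 3 * p ^ 3 - R\<^sup>2 * (coupling a n - a) / 3 * p0 ^ 3
      = R * (coupling a n - a) / 3 * ((y - y0) * (p\<^sup>2 + p * p0 + p0\<^sup>2))"
    by (simp flip: \<open>R * (p - p0) = y - y0\<close>) (simp add: power2_eq_square power3_eq_cube field_simps)
  have B: "coupling a n / (3 * (R\<^sup>2)\<^sup>2) * ((real k + s) ^ 3 - real k ^ 3)
     - coupling a n / (3 * (R\<^sup>2)\<^sup>2) * ((real (base_point n) + s) ^ 3 - real (base_point n) ^ 3)
     = s * (coupling a n * ((y - y0) / R) * ((real k + real (base_point n) + 1) / R\<^sup>2))"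
  proof (cases "s = 0")
    case False
    then have s: "s = 1" using assms by simp
    have "((real k + 1) ^ 3 - real k ^ 3) - ((real (base_point n) + 1) ^ 3 - real (base_point n) ^ 3)
       = 3 * ((R * (y - y0)) * (real k + real (base_point n) + 1))"
      unfolding yd by (simp add: power3_eq_cube algebra_simps)
    moreover have "e / (3 * (R\<^sup>2)\<^sup>2) * (3 * ((R * z) * m)) = e * (z / R) * (m / R\<^sup>2)" for e z m
      using R(1) by (simp add: field_simps power2_eq_square)
    ultimately have "coupling a n / (3 * (R\<^sup>2)\<^sup>2) * (((real k + 1) ^ 3 - real k ^ 3) - ((real (base_point n) + 1) ^ 3 - real (base_point n) ^ 3))
     = coupling a n * ((y - y0) / R) * ((real k + real (base_point n) + 1) / R\<^sup>2)"
      by simp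
    then show ?thesis unfolding s by (simp add: right_diff_distrib)
  qed simp
  show ?thesis
    unfolding entropic_exponent_eq R(2)[symmetric] p_def[symmetric] p0_def[symmetric] F_def[symmetric]
    using A B unfolding R(2) by (simp add: algebra_simps)
qed

lemma entropic_exponent_tendsto:
  fixes k :: "nat \<Rightarrow> nat" and s x :: real
  assumes s: "s \<in> {0, 1}" and k: "\<And>n. k n \<le> card (edges n)" and x: "(\<lambda>n. dev n (k n)) \<longlonglongrightarrow> x"
  shows "(\<lambda>n. entropic_exponent a h n s (k n) - entropic_exponent a h n s (base_point n))
    \<longlonglongrightarrow> curv a u / 2 * x\<^sup>2 - sqrt 2 * a * u\<^sup>2 * x"
proof -
  let ?R = "\<lambda>n. sqrt (lattice_size n)" and ?F = "free_energy a h"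
  obtain q where q: "continuous_on {0..1} q" "q u = curv a u / 2"
    "\<And>v. v \<in> {0..1} \<Longrightarrow> ?F v = ?F u + q v * (v - u)\<^sup>2"
    using quadratic_factor[OF unique_max nondegenerate] by metis
  have Rinf: "filterlim ?R at_top sequentially"
    using sqrt_at_top lattice_size_at_top by (rule filterlim_compose)
  have R0: "(\<lambda>n. inverse (?R n)) \<longlonglongrightarrow> 0"
    by (rule tendsto_inverse_0_at_top[OF Rinf])
  have frac: "(\<lambda>n. (real (j n) + s) / lattice_size n) \<longlonglongrightarrow> u"
    if "(\<lambda>n. dev n (j n)) \<longlonglongrightarrow> z" for j z s
  proof -
    have "(\<lambda>n. inverse (?R n) * (dev n (j n) + s * inverse (?R n)) + u) \<longlonglongrightarrow> 0 * (z + s * 0) + u"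
      by (intro tendsto_intros R0 that)
    moreover have "inverse (?R n) * (dev n (j n) + s * inverse (?R n)) + u = (real (j n) + s) / lattice_size n" for n
    proof -
      have "inverse (?R n) * (?R n * ((real (j n) + s) / lattice_size n - u)) + u = (real (j n) + s) / lattice_size n"
        unfolding mult.assoc[symmetric] using lattice_size_ge_1[of n] by simp
      then show ?thesis unfolding dev_shift by (simp add: divide_inverse)
    qed
    ultimately show ?thesis by simp
  qed
  have main: "(\<lambda>n. (?R n)\<^sup>2 * (?F ((real (j n) + s) / lattice_size n) - ?F u)) \<longlonglongrightarrow> curv a u / 2 * z\<^sup>2"
    if j: "\<And>n. j n \<le> card (edges n)" and z: "(\<lambda>n. dev n (j n)) \<longlonglongrightarrow> z" for j z
  proof -
    have "(\<lambda>n. q ((real (j n) + s) / lattice_size n)) \<longlonglongrightarrow> q u"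
      using continuous_on_tendsto_compose[OF q(1) frac[OF z]] u_interior shifted_fraction[OF j s] by simp
    then have "(\<lambda>n. q ((real (j n) + s) / lattice_size n) * (dev n (j n) + s * inverse (?R n))\<^sup>2)
       \<longlonglongrightarrow> q u * (z + s * 0)\<^sup>2"
      by (intro tendsto_intros R0 z)
    moreover have "q ((real (j n) + s) / lattice_size n) * (dev n (j n) + s * inverse (?R n))\<^sup>2
        = (?R n)\<^sup>2 * (?F ((real (j n) + s) / lattice_size n) - ?F u)" for n
      unfolding divide_inverse[symmetric] dev_shift[symmetric] power_mult_distrib
      using q(3)[OF shifted_fraction[OF j s]] by simp
    ultimately show ?thesis by (simp add: q(2))
  qed
  have m: "(\<lambda>n. dev n (base_point n)) \<longlonglongrightarrow> 0"
    by (rule Lim_null_comparison[OF _ R0]) (use dev_base_point(1) in \<open>auto simp: inverse_eq_divide\<close>)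
  let ?p = "\<lambda>n. (real (k n) + s) / lattice_size n" and ?m = "\<lambda>n. (real (base_point n) + s) / lattice_size n"
  have coupling_shift': "(\<lambda>n. ?R n * (coupling a n - a)) \<longlonglongrightarrow> - sqrt 2 * a"
    using coupling_shift[of a] by (simp add: mult.commute)
  have k0: "(\<lambda>n. real (j n) / lattice_size n) \<longlonglongrightarrow> u" if "(\<lambda>n. dev n (j n)) \<longlonglongrightarrow> z" for j z
    using frac[OF that, of 0] by simp
  have "(\<lambda>n. (real (k n) + real (base_point n) + 1) / lattice_size n) \<longlonglongrightarrow> u + u + 0"
    unfolding add_divide_distrib
    by (intro tendsto_intros k0[OF x] k0[OF m] tendsto_divide_0[OF tendsto_const filterlim_at_top_imp_at_infinity[OF lattice_size_at_top]])
  then have low: "(\<lambda>n. s * (coupling a n * ((dev n (k n) - dev n (base_point n)) * inverse (?R n)) * ((real (k n) + real (base_point n) + 1) / lattice_size n)))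
      \<longlonglongrightarrow> s * (a * ((x - 0) * 0) * (u + u + 0))"
    by (intro tendsto_mult tendsto_diff tendsto_const x m R0 coupling_tendsto)
  have "(\<lambda>n. (dev n (k n) - dev n (base_point n)) * ((?p n)\<^sup>2 + ?p n * ?m n + (?m n)\<^sup>2))
      \<longlonglongrightarrow> (x - 0) * (u\<^sup>2 + u * u + u\<^sup>2)"
    by (intro tendsto_intros frac[OF x] frac[OF m] x m)
  note square = this
  have "(\<lambda>n. ?R n * (coupling a n - a) / 3) \<longlonglongrightarrow> - sqrt 2 * a / 3"
    by (intro tendsto_divide coupling_shift' tendsto_const) simp
  note lims = tendsto_diff[OF tendsto_add[OF tendsto_diff[OF main[OF k x] main[OF base_point_le m]] tendsto_mult[OF this square]] low]
  have limit: "curv a u / 2 * x\<^sup>2 - curv a u / 2 * 0\<^sup>2 + - sqrt 2 * a / 3 * ((x - 0) * (u\<^sup>2 + u * u + u\<^sup>2))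
      - s * (a * ((x - 0) * 0) * (u + u + 0)) = curv a u / 2 * x\<^sup>2 - sqrt 2 * a * u\<^sup>2 * x"
    by (simp add: power2_eq_square)
  show ?thesis
    unfolding entropic_exponent_diff[OF s] divide_inverse[of _ "sqrt (lattice_size _)"] using lims unfolding limit .
qed

text \<open>
  The free energy gives a negative quadratic term in \<open>dev n k\<close>, uniformly over all \<open>k\<close> because the quadratic
  bound is global. All other contributions grow at most linearly and are absorbed.
\<close>

lemma entropic_exponent_upper:
  obtains C c where "0 < c" "\<And>n k s. s \<in> {0, 1} \<Longrightarrow> k \<le> card (edges n) \<Longrightarrow>
    entropic_exponent a h n s k - entropic_exponent a h n s (base_point n) \<le> C - c * (dev n k)\<^sup>2"
proof -
  let ?F = "free_energy a h"
  obtain q where q: "continuous_on {0..1} q"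
    "\<And>v. v \<in> {0..1} \<Longrightarrow> ?F v = ?F u + q v * (v - u)\<^sup>2"
    using quadratic_factor[OF unique_max nondegenerate] by metis
  have "\<exists>w\<in>{0..1}. \<forall>v\<in>{0..1}. q w \<le> q v"
    using q(1) by (intro continuous_attains_inf) auto
  then obtain w where w: "\<And>v. v \<in> {0..1} \<Longrightarrow> q w \<le> q v" by blast
  obtain c where c: "0 < c" "\<And>v. v \<in> {0..1} \<Longrightarrow> ?F v \<le> ?F u - c * (v - u)\<^sup>2"
    using quadratic_bound[OF unique_max nondegenerate] by blast
  have "Bseq (\<lambda>n. (coupling a n - a) * sqrt (lattice_size n))" "Bseq (coupling a)"
    using coupling_shift[of a] coupling_tendsto[of a] convergent_imp_Bseq convergentI by blast+
  then obtain A B where "\<And>n. \<bar>(coupling a n - a) * sqrt (lattice_size n)\<bar> \<le> A" "\<And>n. \<bar>coupling a n\<bar> \<le> B"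
    unfolding Bseq_def by auto
  then have A: "\<bar>sqrt (lattice_size n) * (coupling a n - a)\<bar> \<le> A" and B: "\<bar>coupling a n\<bar> \<le> B" for n
    by (simp_all add: mult.commute)
  have AB: "0 \<le> A" "0 \<le> B" using A[of 0] B[of 0] by linarith+
  define M where "M = A + 2 * B"
  have M: "0 \<le> M" using AB by (simp add: M_def)
  show ?thesis
  proof
    show "0 < c / 4" using c by simp
    fix n k and s :: real assume s: "s \<in> {0, 1}" and k: "k \<le> card (edges n)"
    define R y y0 where "R = sqrt (lattice_size n)" and "y = dev n k" and "y0 = dev n (base_point n)"
    define p p0 where "p = (real k + s) / lattice_size n" and "p0 = (real (base_point n) + s) / lattice_size n"
    have R: "1 \<le> R" using sqrt_size_ge_1 by (simp add: R_def)
    have sR: "0 \<le> s / R" "s / R \<le> 1" using s R by auto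
    have p: "p \<in> {0..1}" "p0 \<in> {0..1}"
      using shifted_fraction[OF k s] shifted_fraction[OF base_point_le s] by (simp_all add: p_def p0_def)
    have Rp: "R * (p - u) = y + s / R" "R * (p0 - u) = y0 + s / R"
      unfolding R_def p_def p0_def y_def y0_def by (rule dev_shift)+
    have y0: "\<bar>y0\<bar> \<le> 1" "y0 \<le> 0" using dev_le_1 dev_base_point(2) by (simp_all add: y0_def)
    have 1: "R\<^sup>2 * (?F p - ?F u) \<le> c - c / 2 * y\<^sup>2"
    proof -
      have "R\<^sup>2 * (?F p - ?F u) \<le> R\<^sup>2 * (- c * (p - u)\<^sup>2)" using c(2)[OF p(1)] by (intro mult_left_mono) auto
      also have "\<dots> = - c * (R * (p - u))\<^sup>2" by (simp add: power_mult_distrib)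
      also have "\<dots> = - c * (y + s / R)\<^sup>2" by (simp add: Rp)
      also have "\<dots> \<le> - c * (y\<^sup>2 / 2 - 1)"
      proof -
        \<comment> \<open>The shift by \<open>s / R\<close> costs half of the quadratic term.\<close>
        have "(s / R)\<^sup>2 \<le> 1" using sR by (simp add: power_le_one)
        moreover have "0 \<le> (y + 2 * (s / R))\<^sup>2" by simp
        moreover have "2 * (y + s / R)\<^sup>2 = y\<^sup>2 + (y + 2 * (s / R))\<^sup>2 - 2 * (s / R)\<^sup>2"
          by (simp add: power2_eq_square algebra_simps)
        ultimately have "y\<^sup>2 / 2 - 1 \<le> (y + s / R)\<^sup>2" by linarith
        then show ?thesis using c(1) by simp
      qed
      finally show ?thesis by (simp add: algebra_simps)
    qed
    have 2: "- (R\<^sup>2 * (?F p0 - ?F u)) \<le> \<bar>q w\<bar>"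
    proof -
      have "- (R\<^sup>2 * (?F p0 - ?F u)) = - q p0 * (R * (p0 - u))\<^sup>2" using q(2)[OF p(2)] by (simp add: power_mult_distrib)
      also have "\<dots> = - q p0 * (y0 + s / R)\<^sup>2" by (simp add: Rp)
      also have "\<dots> \<le> \<bar>q w\<bar> * 1"
      proof (rule mult_mono)
        show "- q p0 \<le> \<bar>q w\<bar>" using w[OF p(2)] by linarith
        have "\<bar>y0 + s / R\<bar> \<le> 1" using y0 sR by (auto simp: abs_le_iff)
        then show "(y0 + s / R)\<^sup>2 \<le> 1" by (simp add: abs_square_le_1)
      qed auto
      finally show ?thesis by simp
    qed
    have yy: "\<bar>y - y0\<bar> \<le> \<bar>y\<bar> + 1" using y0 by linarith
    have 3: "R * (coupling a n - a) / 3 * ((y - y0) * (p\<^sup>2 + p * p0 + p0\<^sup>2)) \<le> A * (\<bar>y\<bar> + 1)"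
    proof -
      have "\<bar>p\<^sup>2 + p * p0 + p0\<^sup>2\<bar> \<le> 3"
      proof -
        have "p\<^sup>2 \<le> 1" "p0\<^sup>2 \<le> 1" "p * p0 \<le> 1" "0 \<le> p * p0" using p by (auto simp: power_le_one mult_le_one)
        then show ?thesis by (simp add: abs_le_iff)
      qed
      then have "\<bar>R * (coupling a n - a) / 3 * ((y - y0) * (p\<^sup>2 + p * p0 + p0\<^sup>2))\<bar> \<le> A / 3 * ((\<bar>y\<bar> + 1) * 3)"
        unfolding abs_mult[of "R * (coupling a n - a) / 3"] abs_mult[of "y - y0"] using A[of n] yy AB
        by (intro mult_mono) (auto simp: R_def)
      then have "R * (coupling a n - a) / 3 * ((y - y0) * (p\<^sup>2 + p * p0 + p0\<^sup>2)) \<le> A / 3 * ((\<bar>y\<bar> + 1) * 3)"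
        by (rule abs_le_D1)
      also have "\<dots> = A * (\<bar>y\<bar> + 1)" by simp
      finally show ?thesis .
    qed
    have 4: "- (s * (coupling a n * ((y - y0) / R) * ((real k + real (base_point n) + 1) / lattice_size n))) \<le> 2 * B * (\<bar>y\<bar> + 1)"
    proof -
      have "\<bar>(y - y0) / R\<bar> \<le> (\<bar>y\<bar> + 1) / 1" using yy R by (simp only: abs_divide) (intro frac_le, auto)
      moreover have "\<bar>(real k + real (base_point n) + 1) / lattice_size n\<bar> \<le> 2"
        using k base_point_le[of n] by (simp add: lattice_size_def abs_le_iff field_simps)
      moreover have "\<bar>s\<bar> \<le> 1" using s by auto
      ultimately have "\<bar>s * (coupling a n * ((y - y0) / R) * ((real k + real (base_point n) + 1) / lattice_size n))\<bar>
         \<le> 1 * (B * ((\<bar>y\<bar> + 1) / 1) * 2)"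
        unfolding abs_mult using B[of n] AB by (intro mult_mono mult_nonneg_nonneg) auto
      then have "- (s * (coupling a n * ((y - y0) / R) * ((real k + real (base_point n) + 1) / lattice_size n)))
         \<le> 1 * (B * ((\<bar>y\<bar> + 1) / 1) * 2)"
        by (rule abs_le_D2)
      also have "\<dots> = 2 * B * (\<bar>y\<bar> + 1)" by simp
      finally show ?thesis .
    qed
    \<comment> \<open>The linear term is absorbed into half of the remaining quadratic term by completing the square.\<close>
    have 5: "M * (\<bar>y\<bar> + 1) \<le> M\<^sup>2 / c + M + c / 4 * y\<^sup>2"
    proof -
      have "0 \<le> (c * \<bar>y\<bar> - 2 * M)\<^sup>2" by simp
      then have "4 * c * (M * \<bar>y\<bar>) \<le> 4 * M\<^sup>2 + c * (c * y\<^sup>2)" by (simp add: power2_diff power_mult_distrib algebra_simps power2_eq_square)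
      then have "M * \<bar>y\<bar> \<le> M\<^sup>2 / c + c / 4 * y\<^sup>2" using c(1) by (simp add: field_simps power2_eq_square)
      then show ?thesis by (simp add: algebra_simps)
    qed
    have "entropic_exponent a h n s k - entropic_exponent a h n s (base_point n)
      \<le> (c - c / 2 * y\<^sup>2) + \<bar>q w\<bar> + A * (\<bar>y\<bar> + 1) + 2 * B * (\<bar>y\<bar> + 1)"
      using entropic_exponent_diff[OF s, of n k] 1 2 3 4
      unfolding R_def[symmetric] p_def[symmetric] p0_def[symmetric] y_def[symmetric] y0_def[symmetric]
      by linarith
    also have "\<dots> = (c - c / 2 * y\<^sup>2) + \<bar>q w\<bar> + M * (\<bar>y\<bar> + 1)" by (simp add: M_def algebra_simps)
    also have "\<dots> \<le> (c + \<bar>q w\<bar> + M\<^sup>2 / c + M) - c / 4 * y\<^sup>2" using 5 by (simp add: algebra_simps)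
    finally show "entropic_exponent a h n s k - entropic_exponent a h n s (base_point n)
      \<le> (c + \<bar>q w\<bar> + M\<^sup>2 / c + M) - c / 4 * (dev n k)\<^sup>2" by (simp add: y_def)
  qed
qed

definition ratio :: "nat \<Rightarrow> nat \<Rightarrow> real" where
  "ratio n k = weight n a h k / weight n a h (base_point n)"

lemma ratio_pos: "k \<le> card (edges n) \<Longrightarrow> 0 < ratio n k"
  using weight_pos base_point_le by (simp add: ratio_def)

lemma ratio_upper:
  obtains C c where "0 < c" "\<And>n k. k \<le> card (edges n) \<Longrightarrow> ratio n k \<le> C * exp (- c * (dev n k)\<^sup>2)"
proof -
  obtain C c where c: "0 < c" and C: "\<And>n k s. s \<in> {0, 1} \<Longrightarrow> k \<le> card (edges n) \<Longrightarrow>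
    entropic_exponent a h n s k - entropic_exponent a h n s (base_point n) \<le> C - c * (dev n k)\<^sup>2"
    using entropic_exponent_upper by metis
  show ?thesis
  proof
    show "0 < c" by fact
    fix n k assume k: "k \<le> card (edges n)"
    have "ln (ratio n k) \<le> C - c * (dev n k)\<^sup>2"
      using log_weight_sandwich(2)[OF base_point_le k, of a h] C[of 0 k n] C[of 1 k n] k
      by (auto simp: ratio_def)
    then have "exp (ln (ratio n k)) \<le> exp (C - c * (dev n k)\<^sup>2)" by simp
    then have "ratio n k \<le> exp (C - c * (dev n k)\<^sup>2)" using ratio_pos[OF k] by simp
    then show "ratio n k \<le> exp C * exp (- c * (dev n k)\<^sup>2)" by (simp flip: exp_add)
  qed
qed

definition profile :: "real \<Rightarrow> real" where
  "profile x = exp (curv a u / 2 * x\<^sup>2 - sqrt 2 * a * u\<^sup>2 * x)"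

lemma ratio_tendsto:
  assumes k: "\<And>n. k n \<le> card (edges n)" and x: "(\<lambda>n. dev n (k n)) \<longlonglongrightarrow> x"
  shows "(\<lambda>n. ratio n (k n)) \<longlonglongrightarrow> profile x"
proof -
  let ?D = "\<lambda>s n. entropic_exponent a h n s (k n) - entropic_exponent a h n s (base_point n)"
  let ?l = "curv a u / 2 * x\<^sup>2 - sqrt 2 * a * u\<^sup>2 * x"
  have l: "?D 0 \<longlonglongrightarrow> ?l" "?D 1 \<longlonglongrightarrow> ?l" using entropic_exponent_tendsto[OF _ k x] by auto
  have "(\<lambda>n. ln (ratio n (k n))) \<longlonglongrightarrow> ?l"
  proof (rule tendsto_sandwich)
    show "\<forall>\<^sub>F n in sequentially. min (?D 0 n) (?D 1 n) \<le> ln (ratio n (k n))"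
      using log_weight_sandwich(1)[OF base_point_le k] by (simp add: ratio_def)
    show "\<forall>\<^sub>F n in sequentially. ln (ratio n (k n)) \<le> max (?D 0 n) (?D 1 n)"
      using log_weight_sandwich(2)[OF base_point_le k] by (simp add: ratio_def)
    show "(\<lambda>n. min (?D 0 n) (?D 1 n)) \<longlonglongrightarrow> ?l" using tendsto_min[OF l] by simp
    show "(\<lambda>n. max (?D 0 n) (?D 1 n)) \<longlonglongrightarrow> ?l" using tendsto_max[OF l] by simp
  qed
  then have "(\<lambda>n. exp (ln (ratio n (k n)))) \<longlonglongrightarrow> profile x"
    unfolding profile_def by (rule tendsto_exp)
  then show ?thesis using ratio_pos[OF k] by simp
qed

end

section \<open>From lattice sums to Gaussian integrals\<close>

definition lattice_step :: "real \<Rightarrow> real \<Rightarrow> nat \<Rightarrow> (nat \<Rightarrow> real) \<Rightarrow> real \<Rightarrow> real" where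
  "lattice_step b R N q x =
     (if 0 \<le> \<lfloor>b + R * x\<rfloor> \<and> \<lfloor>b + R * x\<rfloor> \<le> int N then q (nat \<lfloor>b + R * x\<rfloor>) else 0)"

lemma has_integral_lattice_step:
  assumes R: "0 < R"
  shows "has_bochner_integral lborel (lattice_step b R N q) ((\<Sum>k\<le>N. q k) / R)"
proof -
  let ?I = "\<lambda>k::nat. {(real k - b) / R ..< (real k + 1 - b) / R}"
  have cell: "x \<in> ?I k \<longleftrightarrow> \<lfloor>b + R * x\<rfloor> = int k" for x k
    using R by (auto simp: floor_eq_iff field_simps)
  have pointwise: "lattice_step b R N q x = (\<Sum>k\<le>N. q k * indicator (?I k) x)" for x
  proof (cases "0 \<le> \<lfloor>b + R * x\<rfloor> \<and> \<lfloor>b + R * x\<rfloor> \<le> int N")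
    case True
    then obtain m where m: "\<lfloor>b + R * x\<rfloor> = int m" "m \<le> N" by (metis nat_le_iff nat_0_le)
    have "indicator (?I k) x = (if k = m then 1 else 0 :: real)" for k
      unfolding indicator_def cell m by simp
    then show ?thesis using m by (simp add: lattice_step_def if_distrib[of "\<lambda>t. _ * t"] cong: if_cong)
  next
    case False
    have "indicator (?I k) x = (0::real)" if "k \<le> N" for k
      unfolding indicator_def cell using False that by (simp del: zero_le_floor) (metis of_nat_0_le_iff of_nat_le_iff)
    then show ?thesis using False by (auto simp: lattice_step_def)
  qed
  have "has_bochner_integral lborel (\<lambda>x. \<Sum>k\<le>N. q k * indicator (?I k) x) (\<Sum>k\<le>N. q k * (1 / R))"
  proof (intro has_bochner_integral_sum has_bochner_integral_mult_right)
    fix k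
    have e: "(real k + 1 - b) / R = (real k - b) / R + 1 / R" by (simp add: add_divide_distrib diff_divide_distrib)
    show "has_bochner_integral lborel (indicator (?I k)) (1 / R)"
      unfolding e using R has_bochner_integral_real_indicator[of "{(real k - b) / R ..< (real k - b) / R + 1 / R}" lborel]
      by (simp add: measure_def)
  qed
  then show ?thesis unfolding pointwise[symmetric] by (simp add: sum_divide_distrib)
qed

lemma integrable_gaussian: "0 < c \<Longrightarrow> integrable lborel (\<lambda>x::real. exp (- c * x\<^sup>2))"
proof -
  assume c: "0 < c"
  define s where "s = sqrt (1 / (2 * c))"
  have s: "0 < s" "s\<^sup>2 = 1 / (2 * c)" using c by (simp_all add: s_def)
  have "exp (- c * x\<^sup>2) = sqrt (2 * pi * s\<^sup>2) * normal_density 0 s x" for x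
    using c by (simp add: normal_density_def s(2))
  then show ?thesis using integrable_normal_density[OF s(1)] by simp
qed

text \<open>
  Dominated convergence for the step functions. A point \<open>x\<close> and the lattice point that represents it
  are at distance at most \<open>1 / R n \<le> 1\<close>, so that the Gaussian bound survives with half its exponent.
\<close>

lemma lattice_sums_tendsto:
  fixes q :: "nat \<Rightarrow> nat \<Rightarrow> real" and N :: "nat \<Rightarrow> nat" and b R :: "nat \<Rightarrow> real"
  assumes R: "\<And>n. 1 \<le> R n" and c: "0 < c"
    and bound: "\<And>n k. k \<le> N n \<Longrightarrow> \<bar>q n k\<bar> \<le> C * exp (- c * ((real k - b n) / R n)\<^sup>2)"
    and f: "f \<in> borel_measurable lborel"
    and lim: "AE x in lborel. (\<lambda>n. lattice_step (b n) (R n) (N n) (q n) x) \<longlonglongrightarrow> f x"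
  shows "(\<lambda>n. (\<Sum>k\<le>N n. q n k) / R n) \<longlonglongrightarrow> integral\<^sup>L lborel f"
proof -
  let ?s = "\<lambda>n. lattice_step (b n) (R n) (N n) (q n)"
  let ?w = "\<lambda>x. C * exp c * exp (- (c / 2) * x\<^sup>2)"
  have I: "has_bochner_integral lborel (?s n) ((\<Sum>k\<le>N n. q n k) / R n)" for n
    using R[of n] by (intro has_integral_lattice_step) linarith
  have "0 \<le> C"
  proof -
    have "0 \<le> C * exp (- c * ((real 0 - b 0) / R 0)\<^sup>2)" using bound[of 0 0] by linarith
    then show ?thesis by (simp add: zero_le_mult_iff)
  qed
  have dom: "norm (?s n x) \<le> ?w x" for n x
  proof (cases "0 \<le> \<lfloor>b n + R n * x\<rfloor> \<and> \<lfloor>b n + R n * x\<rfloor> \<le> int (N n)")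
    case True
    then obtain m where m: "\<lfloor>b n + R n * x\<rfloor> = int m" "m \<le> N n" by (metis nat_le_iff nat_0_le)
    define y where "y = (real m - b n) / R n"
    have "real m \<le> b n + R n * x" "b n + R n * x < real m + 1" using m(1) by (simp_all add: floor_eq_iff)
    then have "y \<le> x" "x < y + 1 / R n" using R[of n] by (auto simp: y_def field_simps)
    moreover have "1 / R n \<le> 1" using R[of n] by simp
    ultimately have "\<bar>x - y\<bar> \<le> 1" by linarith
    then have "(x - y)\<^sup>2 \<le> 1" by (simp add: abs_square_le_1)
    moreover have "0 \<le> (x - 2 * y)\<^sup>2" by simp
    ultimately have "x\<^sup>2 / 2 - 1 \<le> y\<^sup>2" by (simp add: power2_eq_square algebra_simps)
    then have "c * (x\<^sup>2 / 2 - 1) \<le> c * y\<^sup>2" using c by simp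
    then have e: "- c * y\<^sup>2 \<le> c + - (c / 2) * x\<^sup>2" by (simp add: algebra_simps)
    have "norm (?s n x) = \<bar>q n m\<bar>" using m by (simp add: lattice_step_def)
    also have "\<dots> \<le> C * exp (- c * y\<^sup>2)" using bound[OF m(2)] by (simp add: y_def)
    also have "\<dots> \<le> C * exp (c + - (c / 2) * x\<^sup>2)" using e \<open>0 \<le> C\<close> by (intro mult_left_mono) auto
    finally show ?thesis by (simp only: exp_add mult.assoc)
  qed (use \<open>0 \<le> C\<close> in \<open>auto simp: lattice_step_def\<close>)
  have "(\<lambda>n. integral\<^sup>L lborel (?s n)) \<longlonglongrightarrow> integral\<^sup>L lborel f"
  proof (rule integral_dominated_convergence[where w = ?w])
    show "integrable lborel ?w" using integrable_gaussian[of "c / 2"] c by simp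
    show "?s n \<in> borel_measurable lborel" for n using I[of n] by (auto simp: has_bochner_integral_iff)
  qed (use f lim dom in auto)
  then show ?thesis unfolding has_bochner_integral_integral_eq[OF I] .
qed

text \<open>
  The expectation of a function of the number of edges; see \<open>mf_expectation\<close>.
\<close>

definition gibbs_mean :: "nat \<Rightarrow> real \<Rightarrow> real \<Rightarrow> (nat \<Rightarrow> real) \<Rightarrow> real" where
  "gibbs_mean n a h \<phi> = (\<Sum>k\<le>card (edges n). \<phi> k * weight n a h k) / (\<Sum>k\<le>card (edges n). weight n a h k)"

context nondegenerate_maximizer
begin

text \<open>
  The parameters of the Gaussian density proportional to \<open>profile\<close>, found by completing the square.
\<close>

definition variance :: real where "variance = - 1 / curv a u"

definition drift :: real where "drift = - sqrt 2 * a * u\<^sup>2 * variance"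

lemma variance_pos: "0 < variance"
  using nondegenerate by (simp add: variance_def)

lemma profile_gaussian:
  obtains z where "0 < z" "\<And>x. profile x = z * normal_density drift (sqrt variance) x"
proof
  let ?z = "exp (drift\<^sup>2 / (2 * variance)) * sqrt (2 * pi * variance)"
  show "0 < ?z" using variance_pos by simp
  fix x
  have "curv a u = - 1 / variance" "- sqrt 2 * a * u\<^sup>2 = drift / variance"
    using nondegenerate variance_pos by (simp_all add: variance_def drift_def)
  moreover have "curv a u / 2 * x\<^sup>2 - sqrt 2 * a * u\<^sup>2 * x = curv a u / 2 * x\<^sup>2 + (- sqrt 2 * a * u\<^sup>2) * x"
    by simp
  ultimately have "curv a u / 2 * x\<^sup>2 - sqrt 2 * a * u\<^sup>2 * x = - (x\<^sup>2) / (2 * variance) + drift / variance * x"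
    by simp
  also have "\<dots> = drift\<^sup>2 / (2 * variance) + - (x - drift)\<^sup>2 / (2 * variance)"
    using variance_pos by (simp add: field_simps power2_eq_square)
  finally have "profile x = exp (drift\<^sup>2 / (2 * variance)) * exp (- (x - drift)\<^sup>2 / (2 * variance))"
    unfolding profile_def by (simp only: exp_add)
  then show "profile x = ?z * normal_density drift (sqrt variance) x"
    using variance_pos by (simp add: normal_density_def)
qed

text \<open>
  For large \<open>n\<close> the lattice point of \<open>x\<close> lies in the admissible range because \<open>u\<close> is interior. Replacing it by
  \<open>0\<close> for the other \<open>n\<close> gives a sequence that is admissible throughout.
\<close>

lemma lattice_step_tendsto:
  assumes "\<And>k. (\<And>n. k n \<le> card (edges n)) \<Longrightarrow> (\<lambda>n. dev n (k n)) \<longlonglongrightarrow> x \<Longrightarrow> (\<lambda>n. q n (k n)) \<longlonglongrightarrow> y"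
  shows "(\<lambda>n. lattice_step (lattice_size n * u) (sqrt (lattice_size n)) (card (edges n)) (q n) x) \<longlonglongrightarrow> y"
proof -
  let ?R = "\<lambda>n. sqrt (lattice_size n)" and ?N = "\<lambda>n. card (edges n)"
  let ?f = "\<lambda>n. \<lfloor>lattice_size n * u + ?R n * x\<rfloor>"
  have Rinf: "filterlim ?R at_top sequentially"
    using sqrt_at_top lattice_size_at_top by (rule filterlim_compose)
  have R0: "(\<lambda>n. inverse (?R n)) \<longlonglongrightarrow> 0"
    by (rule tendsto_inverse_0_at_top[OF Rinf])
  have frac: "(\<lambda>n. u + inverse (?R n) * x) \<longlonglongrightarrow> u + 0 * x"
    by (intro tendsto_intros R0)
  have "\<forall>\<^sub>F n in sequentially. 0 < u + inverse (?R n) * x" "\<forall>\<^sub>F n in sequentially. u + inverse (?R n) * x < 1"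
    using order_tendstoD[OF frac] u_interior by simp_all
  then have ev: "\<forall>\<^sub>F n in sequentially. 0 \<le> ?f n \<and> ?f n \<le> int (?N n)"
  proof eventually_elim
    case (elim n)
    have T: "0 < lattice_size n" "lattice_size n = ?R n * ?R n" "0 < ?R n" using lattice_size_ge_1[of n] by auto
    have e: "lattice_size n * (u + inverse (?R n) * x) = lattice_size n * u + ?R n * x"
    proof -
      have "lattice_size n * inverse (?R n) = ?R n" using T by (metis divide_inverse nonzero_mult_div_cancel_right less_irrefl)
      then show ?thesis by (simp add: distrib_left mult.assoc[symmetric])
    qed
    have "0 < lattice_size n * u + ?R n * x" unfolding e[symmetric] using elim T by simp
    moreover have "lattice_size n * u + ?R n * x < lattice_size n * 1"
      unfolding e[symmetric] using elim T by (intro mult_strict_left_mono) auto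
    ultimately show ?case by (simp add: lattice_size_def floor_le_iff)
  qed
  define k where "k n = (if 0 \<le> ?f n \<and> ?f n \<le> int (?N n) then nat (?f n) else 0)" for n
  have "(\<lambda>n. dev n (k n)) \<longlonglongrightarrow> x"
  proof (rule tendsto_sandwich)
    show "(\<lambda>n. x - inverse (?R n)) \<longlonglongrightarrow> x" using tendsto_diff[OF tendsto_const R0] by simp
    have b: "x - inverse (?R n) \<le> dev n (k n) \<and> dev n (k n) \<le> x" if "0 \<le> ?f n \<and> ?f n \<le> int (?N n)" for n
    proof -
      have R: "0 < ?R n" using lattice_size_ge_1[of n] by auto
      have "real (k n) = real_of_int (?f n)" using that by (simp add: k_def)
      then have "real (k n) \<le> lattice_size n * u + ?R n * x" "lattice_size n * u + ?R n * x < real (k n) + 1" by linarith+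
      moreover have "(x - inverse (?R n)) * ?R n = ?R n * x - 1" using R by (simp add: algebra_simps)
      ultimately show ?thesis
        unfolding dev_def using R by (simp add: pos_le_divide_eq pos_divide_le_eq mult.commute)
    qed
    show "\<forall>\<^sub>F n in sequentially. x - inverse (?R n) \<le> dev n (k n)"
      using ev by eventually_elim (use b in blast)
    show "\<forall>\<^sub>F n in sequentially. dev n (k n) \<le> x"
      using ev by eventually_elim (use b in blast)
  qed simp
  then have "(\<lambda>n. q n (k n)) \<longlonglongrightarrow> y" by (intro assms) (auto simp: k_def nat_le_iff)
  moreover have "\<forall>\<^sub>F n in sequentially. q n (k n)
      = lattice_step (lattice_size n * u) (sqrt (lattice_size n)) (card (edges n)) (q n) x"
    using ev by eventually_elim (simp add: lattice_step_def k_def)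
  ultimately show ?thesis by (rule Lim_transform_eventually)
qed

lemma ratio_sums_tendsto:
  fixes \<Phi> :: "nat \<Rightarrow> nat \<Rightarrow> real"
  assumes bound: "\<And>n k. k \<le> card (edges n) \<Longrightarrow> \<bar>\<Phi> n k\<bar> \<le> A * (1 + (dev n k)\<^sup>2)"
    and meas: "\<psi> \<in> borel_measurable lborel"
    and lim: "AE x in lborel. \<forall>k. (\<forall>n. k n \<le> card (edges n)) \<longrightarrow> (\<lambda>n. dev n (k n)) \<longlonglongrightarrow> x
        \<longrightarrow> (\<lambda>n. \<Phi> n (k n)) \<longlonglongrightarrow> \<psi> x"
  shows "(\<lambda>n. (\<Sum>k\<le>card (edges n). \<Phi> n k * ratio n k) / sqrt (lattice_size n))
    \<longlonglongrightarrow> (\<integral>x. \<psi> x * profile x \<partial>lborel)"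
proof -
  obtain C c where c: "0 < c" and C: "\<And>n k. k \<le> card (edges n) \<Longrightarrow> ratio n k \<le> C * exp (- c * (dev n k)\<^sup>2)"
    using ratio_upper by metis
  have "0 \<le> A"
  proof -
    have "0 \<le> A * (1 + (dev 0 0)\<^sup>2)" using bound[of 0 0] by linarith
    then show ?thesis using zero_le_power2[of "dev 0 0"] by (simp add: zero_le_mult_iff add_pos_nonneg)
  qed
  have "0 \<le> C"
  proof -
    have "0 \<le> C * exp (- c * (dev 0 0)\<^sup>2)" using C[of 0 0] ratio_pos[of 0 0] by linarith
    then show ?thesis by (simp add: zero_le_mult_iff)
  qed
  define K where "K = max 1 (2 / c)"
  have K: "1 \<le> K" "1 \<le> K * (c / 2)" using c by (auto simp: K_def max_def field_simps)
  have poly: "1 + y\<^sup>2 \<le> K * exp (c / 2 * y\<^sup>2)" for y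
  proof -
    have "1 + y\<^sup>2 \<le> K + K * (c / 2) * y\<^sup>2" using K mult_right_mono[OF K(2), of "y\<^sup>2"] by simp
    also have "\<dots> = K * (1 + c / 2 * y\<^sup>2)" by (simp add: algebra_simps)
    also have "\<dots> \<le> K * exp (c / 2 * y\<^sup>2)" using K by (intro mult_left_mono exp_ge_add_one_self) auto
    finally show ?thesis .
  qed
  show ?thesis
  proof (rule lattice_sums_tendsto[where b = "\<lambda>n. lattice_size n * u" and c = "c / 2" and C = "A * K * C"])
    show "1 \<le> sqrt (lattice_size n)" for n by (rule sqrt_size_ge_1)
    show "0 < c / 2" using c by simp
    show "(\<lambda>x. \<psi> x * profile x) \<in> borel_measurable lborel"
      unfolding profile_def using meas by measurable
    fix n k assume k: "k \<le> card (edges n)"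
    let ?y = "dev n k"
    have "\<bar>\<Phi> n k * ratio n k\<bar> = \<bar>\<Phi> n k\<bar> * ratio n k" using ratio_pos[OF k] by (simp add: abs_mult)
    also have "\<dots> \<le> (A * (K * exp (c / 2 * ?y\<^sup>2))) * (C * exp (- c * ?y\<^sup>2))"
    proof (rule mult_mono)
      show "\<bar>\<Phi> n k\<bar> \<le> A * (K * exp (c / 2 * ?y\<^sup>2))"
        using bound[OF k] mult_left_mono[OF poly[of ?y] \<open>0 \<le> A\<close>] by linarith
    qed (use C[OF k] ratio_pos[OF k] \<open>0 \<le> A\<close> K in auto)
    also have "\<dots> = A * K * C * (exp (c / 2 * ?y\<^sup>2) * exp (- c * ?y\<^sup>2))" by (simp add: ac_simps)
    also have "exp (c / 2 * ?y\<^sup>2) * exp (- c * ?y\<^sup>2) = exp (- (c / 2) * ?y\<^sup>2)"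
      unfolding exp_add[symmetric] by (simp add: algebra_simps)
    finally show "\<bar>\<Phi> n k * ratio n k\<bar> \<le> A * K * C * exp (- (c / 2) * ((real k - lattice_size n * u) / sqrt (lattice_size n))\<^sup>2)"
      by (simp add: dev_def)
  next
    show "AE x in lborel. (\<lambda>n. lattice_step (lattice_size n * u) (sqrt (lattice_size n)) (card (edges n))
        (\<lambda>k. \<Phi> n k * ratio n k) x) \<longlonglongrightarrow> \<psi> x * profile x"
      using lim by eventually_elim (intro lattice_step_tendsto tendsto_mult ratio_tendsto, auto)
  qed
qed

text \<open>
  The limit law of the rescaled edge count, tested against functions of quadratic growth. The
  test functions may depend on \<open>n\<close>, which allows centring at the exact mean. Convergence is
  required along all admissible lattice sequences but only for almost every limit point, which admits
  indicator functions.
\<close>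

lemma gibbs_mean_tendsto:
  fixes \<Phi> :: "nat \<Rightarrow> nat \<Rightarrow> real"
  assumes bound: "\<And>n k. k \<le> card (edges n) \<Longrightarrow> \<bar>\<Phi> n k\<bar> \<le> A * (1 + (dev n k)\<^sup>2)"
    and meas: "\<psi> \<in> borel_measurable lborel"
    and lim: "AE x in lborel. \<forall>k. (\<forall>n. k n \<le> card (edges n)) \<longrightarrow> (\<lambda>n. dev n (k n)) \<longlonglongrightarrow> x
        \<longrightarrow> (\<lambda>n. \<Phi> n (k n)) \<longlonglongrightarrow> \<psi> x"
  shows "(\<lambda>n. gibbs_mean n a h (\<Phi> n)) \<longlonglongrightarrow> (\<integral>x. normal_density drift (sqrt variance) x * \<psi> x \<partial>lborel)"
proof -
  obtain z where z: "0 < z" "\<And>x. profile x = z * normal_density drift (sqrt variance) x"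
    using profile_gaussian by metis
  have "(\<lambda>n. (\<Sum>k\<le>card (edges n). 1 * ratio n k) / sqrt (lattice_size n)) \<longlonglongrightarrow> (\<integral>x. 1 * profile x \<partial>lborel)"
    by (rule ratio_sums_tendsto[where A = 1 and \<Phi> = "\<lambda>_ _. 1"]) auto
  moreover have "(\<integral>x. 1 * profile x \<partial>lborel) = z" using variance_pos by (simp add: z(2))
  ultimately have norm: "(\<lambda>n. (\<Sum>k\<le>card (edges n). ratio n k) / sqrt (lattice_size n)) \<longlonglongrightarrow> z" by simp
  have "(\<integral>x. \<psi> x * profile x \<partial>lborel) = (\<integral>x. z * (normal_density drift (sqrt variance) x * \<psi> x) \<partial>lborel)"
    by (intro Bochner_Integration.integral_cong) (auto simp: z(2))
  then have e: "(\<integral>x. \<psi> x * profile x \<partial>lborel) / z = (\<integral>x. normal_density drift (sqrt variance) x * \<psi> x \<partial>lborel)"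
    using z(1) by simp
  have "gibbs_mean n a h (\<Phi> n) = ((\<Sum>k\<le>card (edges n). \<Phi> n k * ratio n k) / sqrt (lattice_size n))
      / ((\<Sum>k\<le>card (edges n). ratio n k) / sqrt (lattice_size n))" for n
    using lattice_size_ge_1[of n] weight_pos[OF base_point_le, of n a h]
    by (simp add: gibbs_mean_def ratio_def sum_divide_distrib[symmetric])
  then show ?thesis
    using tendsto_divide[OF ratio_sums_tendsto[OF assms] norm] z(1) by (simp add: e)
qed

end

section \<open>The law of the edge count\<close>

lemma finite_edges [simp]: "finite (edges n)"
  by (rule finite_subset[of _ "Pow {1..n}"]) (auto simp: edges_def)

text \<open>
  Configurations are subsets of the edge set, and grouping subsets by cardinality produces the binomial
  coefficients.
\<close>

lemma sum_configs:
  fixes G :: "real \<Rightarrow> real"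
  shows "(\<Sum>x\<in>configs n. G (S_n n x)) = (\<Sum>k\<le>card (edges n). real (card (edges n) choose k) * G (real k))"
proof -
  let ?E = "edges n"
  have "(\<Sum>x\<in>configs n. G (S_n n x)) = (\<Sum>A\<in>Pow ?E. G (real (card A)))"
  proof (rule sum.reindex_bij_witness[where j = "\<lambda>x. {e\<in>?E. x e = 1}"
        and i = "\<lambda>A. restrict (indicator A) ?E"])
    fix x assume x: "x \<in> configs n"
    then have v: "x e \<in> {0, 1}" if "e \<in> ?E" for e using that by (auto simp: configs_def PiE_def Pi_def)
    show "restrict (indicator {e\<in>?E. x e = 1}) ?E = x"
    proof
      fix e show "restrict (indicator {e\<in>?E. x e = 1}) ?E e = x e"
        using x v[of e] by (cases "e \<in> ?E") (auto simp: configs_def PiE_def extensional_def)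
    qed
    have "S_n n x = (\<Sum>e\<in>?E. if x e = 1 then 1 else 0)"
      unfolding S_n_def using v by (intro sum.cong) auto
    also have "\<dots> = real (card {e\<in>?E. x e = 1})" by (simp add: sum.If_cases Int_def)
    finally show "G (real (card {e\<in>?E. x e = 1})) = G (S_n n x)" by simp
  next
    fix A assume "A \<in> Pow ?E"
    then show "{e\<in>?E. restrict (indicator A) ?E e = (1::real)} = A"
      "restrict (indicator A) ?E \<in> configs n"
      by (auto simp: configs_def indicator_def)
  qed auto
  also have "\<dots> = (\<Sum>k\<le>card ?E. \<Sum>A\<in>{A\<in>Pow ?E. card A = k}. G (real (card A)))"
    by (rule sum.group[symmetric]) (auto intro: card_mono)
  also have "\<dots> = (\<Sum>k\<le>card ?E. real (card ?E choose k) * G (real k))"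
  proof (rule sum.cong[OF refl])
    fix k
    have "card {A\<in>Pow ?E. card A = k} = card ?E choose k" using n_subsets[of ?E k] by simp
    then show "(\<Sum>A\<in>{A\<in>Pow ?E. card A = k}. G (real (card A))) = real (card ?E choose k) * G (real k)" by simp
  qed
  finally show ?thesis .
qed

lemma finite_configs [simp]: "finite (configs n)"
  unfolding configs_def by (intro finite_PiE) auto

lemma partition_fun_eq: "partition_fun n a h = (\<Sum>k\<le>card (edges n). weight n a h k)"
  unfolding partition_fun_def hamiltonian_def S_n_def[symmetric] weight_def
  by (rule sum_configs)

lemma partition_fun_pos: "0 < partition_fun n a h"
  unfolding partition_fun_eq by (intro sum_pos weight_pos) auto

lemma mf_expectation:
  fixes \<phi> :: "real \<Rightarrow> real"
  shows "(\<integral>x. \<phi> (S_n n x) \<partial>mf_measure n a h)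
    = (\<Sum>k\<le>card (edges n). \<phi> (real k) * weight n a h k) / (\<Sum>k\<le>card (edges n). weight n a h k)"
proof -
  have "(\<integral>x. \<phi> (S_n n x) \<partial>mf_measure n a h)
     = (\<Sum>x\<in>configs n. exp (hamiltonian n a h x) / partition_fun n a h * \<phi> (S_n n x))"
    unfolding mf_measure_def using partition_fun_pos[of n a h]
    by (subst lebesgue_integral_point_measure_finite) auto
  also have "\<dots> = (\<Sum>x\<in>configs n. exp (hamiltonian n a h x) * \<phi> (S_n n x)) / partition_fun n a h"
    by (simp add: sum_divide_distrib)
  also have "(\<Sum>x\<in>configs n. exp (hamiltonian n a h x) * \<phi> (S_n n x))
      = (\<Sum>k\<le>card (edges n). \<phi> (real k) * weight n a h k)"
    unfolding hamiltonian_def S_n_def[symmetric] weight_def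
    using sum_configs[of "\<lambda>s. exp (4 * a / (3 * real n ^ 4) * s ^ 3 + h * s) * \<phi> s" n]
    by (simp add: ac_simps)
  finally show ?thesis by (simp add: partition_fun_eq)
qed

lemma sum_weight_pos: "0 < (\<Sum>k\<le>card (edges n). weight n a h k)"
  using partition_fun_pos[of n a h] by (simp add: partition_fun_eq)

lemma gibbs_mean_linear:
  "gibbs_mean n a h (\<lambda>k. c * \<phi> k + d * \<psi> k + e) = c * gibbs_mean n a h \<phi> + d * gibbs_mean n a h \<psi> + e"
proof -
  let ?N = "card (edges n)" and ?w = "weight n a h"
  have "(\<Sum>k\<le>?N. (c * \<phi> k + d * \<psi> k + e) * ?w k)
      = c * (\<Sum>k\<le>?N. \<phi> k * ?w k) + d * (\<Sum>k\<le>?N. \<psi> k * ?w k) + e * (\<Sum>k\<le>?N. ?w k)"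
    by (simp add: distrib_right sum.distrib sum_distrib_left mult.assoc)
  then show ?thesis
    using sum_weight_pos[of n a h] by (simp add: gibbs_mean_def add_divide_distrib)
qed

lemma m_n_eq: "m_n n a h = 2 / real n ^ 2 * gibbs_mean n a h real"
  unfolding m_n_def using mf_expectation[where \<phi> = "\<lambda>s. 2 * s / real n ^ 2"]
  by (simp add: gibbs_mean_def sum_distrib_left[symmetric] sum_divide_distrib[symmetric] mult.assoc)

lemma DERIV_weight: "((\<lambda>t. weight n a t k) has_real_derivative real k * weight n a h k) (at h)"
  unfolding weight_def by (auto intro!: derivative_eq_intros)

text \<open>
  Differentiating a Gibbs average with respect to the field gives a covariance with the edge count.
\<close>

lemma v_n_eq:
  "v_n n a h = 2 / real n ^ 2 * (gibbs_mean n a h (\<lambda>k. (real k)\<^sup>2) - (gibbs_mean n a h real)\<^sup>2)"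
proof -
  let ?N = "card (edges n)"
  let ?Z = "\<lambda>t. \<Sum>k\<le>?N. weight n a t k"
  let ?M = "\<lambda>t. \<Sum>k\<le>?N. real k * weight n a t k"
  let ?Q = "\<Sum>k\<le>?N. (real k)\<^sup>2 * weight n a h k"
  have Z: "?Z h \<noteq> 0" using sum_weight_pos[of n a h] by simp
  have "(?Z has_real_derivative ?M h) (at h)"
    by (rule DERIV_sum) (rule DERIV_weight)
  moreover have "(?M has_real_derivative ?Q) (at h)"
    by (rule DERIV_sum) (auto intro!: derivative_eq_intros DERIV_weight simp: power2_eq_square)
  ultimately have "((\<lambda>t. ?M t / ?Z t) has_real_derivative (?Q * ?Z h - ?M h * ?M h) / (?Z h * ?Z h)) (at h)"
    using Z by (intro DERIV_divide) auto
  then have "((\<lambda>t. 2 / real n ^ 2 * (?M t / ?Z t)) has_real_derivative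
      2 / real n ^ 2 * ((?Q * ?Z h - ?M h * ?M h) / (?Z h * ?Z h))) (at h)"
    by (rule DERIV_cmult)
  moreover have "(?Q * ?Z h - ?M h * ?M h) / (?Z h * ?Z h) = ?Q / ?Z h - (?M h / ?Z h)\<^sup>2"
    using Z by (simp add: diff_divide_distrib power2_eq_square)
  ultimately show ?thesis
    unfolding v_n_def m_n_eq gibbs_mean_def by (metis (no_types, lifting) DERIV_imp_deriv)
qed

section \<open>The fluctuations of the edge count\<close>

lemma cdf_normal_shifted:
  assumes "0 < \<sigma>"
  shows "cdf (density lborel (normal_density 0 \<sigma>)) b
    = (\<integral>x. normal_density \<mu> \<sigma> x * indicator {..b} (x - \<mu>) \<partial>lborel)"
proof -
  have "(\<integral>x. normal_density \<mu> \<sigma> x * indicator {..b} (x - \<mu>) \<partial>lborel)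
      = \<bar>1\<bar> *\<^sub>R (\<integral>x. normal_density \<mu> \<sigma> (\<mu> + 1 * x) * indicator {..b} (\<mu> + 1 * x - \<mu>) \<partial>lborel)"
    by (rule lborel_integral_real_affine) simp
  also have "\<dots> = (\<integral>x. normal_density 0 \<sigma> x * indicator {..b} x \<partial>lborel)"
    by (simp add: normal_density_def)
  also have "\<dots> = (\<integral>x. indicator {..b} x \<partial>density lborel (normal_density 0 \<sigma>))"
    by (subst integral_density) auto
  also have "\<dots> = cdf (density lborel (normal_density 0 \<sigma>)) b" by (simp add: cdf_def)
  finally show ?thesis by simp
qed

context nondegenerate_maximizer
begin

lemma count_dev: "real k = lattice_size n * u + sqrt (lattice_size n) * dev n k"
  using lattice_size_ge_1[of n] by (simp add: dev_def)

lemma mean_dev_tendsto: "(\<lambda>n. gibbs_mean n a h (dev n)) \<longlonglongrightarrow> drift"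
proof -
  have "\<bar>y\<bar> \<le> 1 * (1 + y\<^sup>2)" for y :: real
  proof -
    have "0 \<le> (\<bar>y\<bar> - 1)\<^sup>2" by simp
    then show ?thesis by (simp add: power2_diff)
  qed
  then have "(\<lambda>n. gibbs_mean n a h (dev n)) \<longlonglongrightarrow> (\<integral>x. normal_density drift (sqrt variance) x * x \<partial>lborel)"
    by (intro gibbs_mean_tendsto[where A = 1 and \<psi> = "\<lambda>x. x"]) auto
  then show ?thesis using integral_normal_moment_nz_1[of "sqrt variance" drift] variance_pos by simp
qed

text \<open>
  The deviations are centred at the limiting mean, where the Gaussian moments are simplest. The exact mean is
  restored in \<open>v_n_tendsto\<close> and costs only the square of \<open>gibbs_mean n a h (dev n) - drift\<close>.
\<close>

lemma mean_square_dev_tendsto: "(\<lambda>n. gibbs_mean n a h (\<lambda>k. (dev n k - drift)\<^sup>2)) \<longlonglongrightarrow> variance"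
proof -
  let ?A = "2 * (1 + drift\<^sup>2)"
  have "\<bar>(y - drift)\<^sup>2\<bar> \<le> ?A * (1 + y\<^sup>2)" for y :: real
  proof -
    have "(y - drift)\<^sup>2 \<le> 2 * y\<^sup>2 + 2 * drift\<^sup>2"
      using zero_le_power2[of "y + drift"] by (simp add: power2_diff power2_sum)
    also have "\<dots> \<le> ?A * (1 + y\<^sup>2)" by (simp add: algebra_simps)
    finally show ?thesis by simp
  qed
  then have "(\<lambda>n. gibbs_mean n a h (\<lambda>k. (dev n k - drift)\<^sup>2))
      \<longlonglongrightarrow> (\<integral>x. normal_density drift (sqrt variance) x * (x - drift)\<^sup>2 \<partial>lborel)"
    by (intro gibbs_mean_tendsto[where A = ?A]) (auto intro!: tendsto_intros)
  then show ?thesis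
    using integral_normal_moment_even[of "sqrt variance" drift 1] variance_pos by (simp add: fact_numeral)
qed

lemma v_n_tendsto: "(\<lambda>n. v_n n a h) \<longlonglongrightarrow> variance"
proof -
  have "v_n n a h = 2 * lattice_size n / real n ^ 2 *
      (gibbs_mean n a h (\<lambda>k. (dev n k - drift)\<^sup>2) - (gibbs_mean n a h (dev n) - drift)\<^sup>2)" for n
  proof -
    define R T m where "R = sqrt (lattice_size n)" and "T = lattice_size n" and "m = gibbs_mean n a h (dev n)"
    let ?b = "T * u + R * drift"
    have R: "R\<^sup>2 = T" using lattice_size_ge_1[of n] by (simp add: R_def T_def)
    \<comment> \<open>The summand \<open>0 * 0\<close> makes this an instance of the three-term linearity rule.\<close>
    have "real = (\<lambda>k. R * dev n k + 0 * 0 + T * u)" using count_dev[of _ n] by (auto simp: R_def T_def)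
    then have m1: "gibbs_mean n a h real = R * m + T * u"
      using gibbs_mean_linear[of n a h R "dev n" 0 "\<lambda>_. 0" "T * u"] by (simp add: m_def)
    have "(real k)\<^sup>2 = R\<^sup>2 * (dev n k - drift)\<^sup>2 + 2 * R * ?b * dev n k + (?b\<^sup>2 - 2 * R * ?b * drift)" for k
    proof -
      have "real k = ?b + R * (dev n k - drift)"
        using count_dev[of k n] by (simp add: R_def T_def algebra_simps)
      then show ?thesis by (simp add: power2_eq_square algebra_simps)
    qed
    then have m2: "gibbs_mean n a h (\<lambda>k. (real k)\<^sup>2) = R\<^sup>2 * gibbs_mean n a h (\<lambda>k. (dev n k - drift)\<^sup>2)
        + 2 * R * ?b * m + (?b\<^sup>2 - 2 * R * ?b * drift)"
      using gibbs_mean_linear[of n a h "R\<^sup>2" "\<lambda>k. (dev n k - drift)\<^sup>2" "2 * R * ?b" "dev n" "?b\<^sup>2 - 2 * R * ?b * drift"]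
      by (simp add: m_def)
    have "gibbs_mean n a h (\<lambda>k. (real k)\<^sup>2) - (gibbs_mean n a h real)\<^sup>2
        = R\<^sup>2 * (gibbs_mean n a h (\<lambda>k. (dev n k - drift)\<^sup>2) - (m - drift)\<^sup>2)"
      unfolding m1 m2 by (simp add: power2_eq_square algebra_simps)
    then show ?thesis unfolding v_n_eq R by (simp add: T_def m_def)
  qed
  moreover have "(\<lambda>n. 2 * lattice_size n / real n ^ 2 *
      (gibbs_mean n a h (\<lambda>k. (dev n k - drift)\<^sup>2) - (gibbs_mean n a h (dev n) - drift)\<^sup>2))
      \<longlonglongrightarrow> 1 * (variance - (drift - drift)\<^sup>2)"
    by (intro tendsto_intros size_ratio mean_dev_tendsto mean_square_dev_tendsto)
  ultimately show ?thesis by simp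
qed

definition fluctuation :: "nat \<Rightarrow> real \<Rightarrow> real" where
  "fluctuation n s = sqrt 2 * ((s - real n ^ 2 / 2 * m_n n a h) / real n)"

text \<open>
  Subtracting the exact mean removes the centre \<open>T * u\<close>; the displacement by \<open>drift\<close> then cancels in the limit.
\<close>

lemma fluctuation_eq:
  "fluctuation n (real k) = sqrt 2 * sqrt (lattice_size n) / real n * (dev n k - gibbs_mean n a h (dev n))"
proof (cases "n = 0")
  case False
  have "real = (\<lambda>k. sqrt (lattice_size n) * dev n k + 0 * 0 + lattice_size n * u)"
    using count_dev[of _ n] by auto
  then have "gibbs_mean n a h real = sqrt (lattice_size n) * gibbs_mean n a h (dev n) + lattice_size n * u"
    using gibbs_mean_linear[of n a h "sqrt (lattice_size n)" "dev n" 0 "\<lambda>_. 0" "lattice_size n * u"] by simp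
  moreover have "real n ^ 2 / 2 * m_n n a h = gibbs_mean n a h real" using False by (simp add: m_n_eq)
  ultimately have "real k - real n ^ 2 / 2 * m_n n a h = sqrt (lattice_size n) * (dev n k - gibbs_mean n a h (dev n))"
    using count_dev[of k n] by (simp add: algebra_simps)
  then show ?thesis by (simp add: fluctuation_def)
qed (simp add: fluctuation_def)

lemma cdf_fluctuation:
  "cdf (distr (mf_measure n a h) borel (\<lambda>x. fluctuation n (S_n n x))) b
    = gibbs_mean n a h (\<lambda>k. indicator {..b} (fluctuation n (real k)))"
proof -
  let ?M = "mf_measure n a h"
  have meas [measurable]: "(\<lambda>x. f (S_n n x)) \<in> borel_measurable ?M" for f :: "real \<Rightarrow> real"
    by (simp add: mf_measure_def)
  have "cdf (distr ?M borel (\<lambda>x. fluctuation n (S_n n x))) b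
      = (\<integral>y. indicator {..b} y \<partial>distr ?M borel (\<lambda>x. fluctuation n (S_n n x)))"
    by (simp add: cdf_def)
  also have "\<dots> = (\<integral>x. indicator {..b} (fluctuation n (S_n n x)) \<partial>?M)"
    by (rule integral_distr) simp_all
  also have "\<dots> = gibbs_mean n a h (\<lambda>k. indicator {..b} (fluctuation n (real k)))"
    unfolding gibbs_mean_def by (rule mf_expectation)
  finally show ?thesis .
qed

text \<open>
  The indicator of \<open>{..b}\<close> is continuous except at \<open>b\<close>, and a single
  limit point is negligible for the Gaussian law; hence the distribution functions converge everywhere.
\<close>

lemma fluctuation_weak_conv:
  "weak_conv_m (\<lambda>n. distr (mf_measure n a h) borel (\<lambda>x. fluctuation n (S_n n x)))
     (density lborel (normal_density 0 (sqrt variance)))"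
  unfolding weak_conv_m_def weak_conv_def
proof (intro allI impI)
  fix b
  have "(\<lambda>n. gibbs_mean n a h (\<lambda>k. indicator {..b} (fluctuation n (real k))))
     \<longlonglongrightarrow> (\<integral>x. normal_density drift (sqrt variance) x * indicator {..b} (x - drift) \<partial>lborel)"
  proof (rule gibbs_mean_tendsto[where A = 1])
    have "AE x in lborel. x \<noteq> drift + b" by (rule AE_lborel_singleton)
    then show "AE x in lborel. \<forall>k. (\<forall>n. k n \<le> card (edges n)) \<longrightarrow> (\<lambda>n. dev n (k n)) \<longlonglongrightarrow> x
        \<longrightarrow> (\<lambda>n. indicator {..b} (fluctuation n (real (k n)))) \<longlonglongrightarrow> (indicator {..b} (x - drift) :: real)"
    proof eventually_elim
      case (elim x)
      show ?case
      proof (intro allI impI)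
        fix k :: "nat \<Rightarrow> nat" assume k: "(\<lambda>n. dev n (k n)) \<longlonglongrightarrow> x"
        have "(\<lambda>n. sqrt 2 * sqrt (lattice_size n) / real n * (dev n (k n) - gibbs_mean n a h (dev n))) \<longlonglongrightarrow> 1 * (x - drift)"
          by (intro tendsto_intros sqrt_size_ratio k mean_dev_tendsto)
        then have l: "(\<lambda>n. fluctuation n (real (k n))) \<longlonglongrightarrow> x - drift" by (simp add: fluctuation_eq)
        consider "x - drift < b" | "b < x - drift" using elim by linarith
        then have "\<forall>\<^sub>F n in sequentially. indicator {..b} (x - drift) = (indicator {..b} (fluctuation n (real (k n))) :: real)"
        proof cases
          case 1
          show ?thesis using order_tendstoD(2)[OF l 1] by eventually_elim (use 1 in \<open>simp add: indicator_def\<close>)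
        next
          case 2
          show ?thesis using order_tendstoD(1)[OF l 2] by eventually_elim (use 2 in \<open>simp add: indicator_def\<close>)
        qed
        then show "(\<lambda>n. indicator {..b} (fluctuation n (real (k n)))) \<longlonglongrightarrow> (indicator {..b} (x - drift) :: real)"
          by (rule Lim_transform_eventually[OF tendsto_const])
      qed
    qed
  qed (auto simp: indicator_def)
  then show "(\<lambda>n. cdf (distr (mf_measure n a h) borel (\<lambda>x. fluctuation n (S_n n x))) b)
      \<longlonglongrightarrow> cdf (density lborel (normal_density 0 (sqrt variance))) b"
    using cdf_normal_shifted[of "sqrt variance" b drift] variance_pos by (simp add: cdf_fluctuation)
qed

end

theorem theorem9p5:
  fixes \<alpha> h :: real
  assumes "(\<alpha>, h) \<in> U_rs - {(\<alpha>\<^sub>c, h\<^sub>c)}"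
  shows "(\<lambda>n. v_n n \<alpha> h) \<longlonglongrightarrow> v_lim \<alpha> h
    \<and> ((\<lambda>t. u_star \<alpha> t) has_real_derivative v_lim \<alpha> h) (at h)
    \<and> 0 < v_lim \<alpha> h
    \<and> weak_conv_m
        (\<lambda>n. distr (mf_measure n \<alpha> h) borel
           (\<lambda>x. sqrt 2 * ((S_n n x - real n ^ 2 / 2 * m_n n \<alpha> h) / real n)))
        (density lborel (normal_density 0 (sqrt (v_lim \<alpha> h))))"
proof -
  have off_curve: "(\<alpha>, h) \<notin> M_rs" and not_critical: "(\<alpha>, h) \<noteq> (\<alpha>\<^sub>c, h\<^sub>c)"
    using assms by (auto simp: U_rs_def)
  define u where "u = u_star \<alpha> h"
  have max: "maximizers \<alpha> h = {u}"
    using maximizers_eq_u_star[OF off_curve] by (simp add: u_def)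
  interpret nondegenerate_maximizer \<alpha> h u
    using max maximizer_nondegenerate[OF _ not_critical, of u] by unfold_locales auto
  have lim: "v_lim \<alpha> h = variance"
    unfolding v_lim_def using v_n_tendsto by (rule limI)
  have "((\<lambda>t. u_star \<alpha> t) has_real_derivative variance) (at h)"
    unfolding variance_def unfolding u_def by (rule DERIV_u_star[OF off_curve not_critical])
  then show ?thesis
    unfolding lim
    using v_n_tendsto variance_pos fluctuation_weak_conv[unfolded fluctuation_def]
    by blast
qed

end
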